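(* Let $n\ge 1$. For every generalized partial term order $\prec$ on the set of subsets of $[n]$, the induced map $\sigma_\prec$ on the cocircuits of the oriented matroid $\mathcal M(B_n)$ is a localization. Consequently, via $\prec\ \mapsto$ (the one-element extension of $\mathcal M(B_n)$ determined by $\sigma_\prec$), the set of generalized partial term orders on subsets of $[n]$ is in bijection with a subset of the set of one-element extensions of $\mathcal M(B_n)$.
   Context: Write $[n]=\{1,\dots,n\}$. A generalized partial term order is an irreflexive (strict) partial order $\prec$ on the set of subsets of $[n]$ such that: (1) $\alpha\prec\beta \Leftrightarrow \alpha\cup\gamma\prec\beta\cup\gamma$ for all $\gamma\subseteq[n]$ with $\gamma\cap(\alpha\cup\beta)=\emptyset$; (2) if $\alpha$ and $\beta$ are not comparable (written $\alpha\sim\beta$), then $\{\gamma:\gamma\prec\alpha\}=\{\gamma:\gamma\prec\beta\}$ and $\{\gamma:\alpha\prec\gamma\}=\{\gamma:\beta\prec\gamma\}$. $B_n=\{e_i:1\le i\le n\}\cup\{e_i-e_j,\ e_i+e_j:1\le i<j\le n\}\subset\mathbb R^n$, where $e_i$ is the $i$th standard basis vector, and $\mathcal M(B_n)$ is the (rank $n$) oriented matroid of this vector configuration. The cocircuits of $\mathcal M(B_n)$ are in bijection with the nonzero sign vectors $X\in\{+,0,-\}^n$; the cocircuit $\overline X\in\{+,0,-\}^{B_n}$ corresponding to $X$ is given by $\overline X_{e_i}=X_i$, $\overline X_{e_i+e_j}=X_i+X_j$, $\overline X_{e_i-e_j}=X_i-X_j$, where sums and differences of elements of $\{+,0,-\}$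 mean the sign of the corresponding operation on $\{+1,0,-1\}$. For a sign vector $X$ put $X^+=\{i:X_i=+\}$ and $X^-=\{i:X_i=-\}$. A generalized partial term order $\prec$ induces a function $\mu_\prec$ on $\{+,0,-\}^n$ by $\mu_\prec(X)=+$ if $X^-\prec X^+$, $\mu_\prec(X)=-$ if $X^+\prec X^-$, and $\mu_\prec(X)=0$ otherwise. The induced function on cocircuits of $\mathcal M(B_n)$ is $\sigma_\prec(\overline X)=\mu_\prec(X)$. A one-element extension of an oriented matroid $\mathcal M$ on ground set $E$ is an oriented matroid $\mathcal M'$ of the same rank on $E\sqcup\{p\}$ whose restriction to $E$ is $\mathcal M$ ($p$ may be a loop). A function $\sigma$ from the cocircuits of $\mathcal M$ to $\{+,0,-\}$ is a localization if there is a one-element extension $\mathcal M'$ of $\mathcal M$ such that for each cocircuit $C$ of $\mathcal M$, the sign vector on $E\sqcup\{p\}$ that agrees with $C$ on $E$ and has value $\sigma(C)$ at $p$ is a cocircuit of $\mathcal M'$; the extension is uniquely determined by $\sigma$. *)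

theory Defs
  imports "HOL-Analysis.Analysis"
begin

section \<open>Sign vectors\<close>

text \<open>
  The signs +, 0, - are the integers 1, 0, -1. A sign vector on a ground set \<open>E\<close> is a function
  that vanishes outside \<open>E\<close>, so that a sign vector is determined by its values on \<open>E\<close>.
\<close>

definition sign_vectors :: "'e set \<Rightarrow> ('e \<Rightarrow> int) set" where
  "sign_vectors E = {X. (\<forall>e. X e \<in> {- 1, 0, 1}) \<and> (\<forall>e. e \<notin> E \<longrightarrow> X e = 0)}"

definition pos_part :: "('e \<Rightarrow> int) \<Rightarrow> 'e set" where
  "pos_part X = {e. X e = 1}"

definition neg_part :: "('e \<Rightarrow> int) \<Rightarrow> 'e set" where
  "neg_part X = {e. X e = - 1}"

definition sv_support :: "('e \<Rightarrow> int) \<Rightarrow> 'e set" where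
  "sv_support X = {e. X e \<noteq> 0}"

definition minimal_sign_vectors :: "('e \<Rightarrow> int) set \<Rightarrow> ('e \<Rightarrow> int) set" where
  "minimal_sign_vectors S =
     {X \<in> S. sv_support X \<noteq> {} \<and>
        (\<forall>Y\<in>S. sv_support Y \<noteq> {} \<longrightarrow> \<not> sv_support Y \<subset> sv_support X)}"


section \<open>Oriented matroids given by their cocircuits\<close>

text \<open>
  An oriented matroid on \<open>E\<close> is represented by its set \<open>D\<close> of cocircuits. These satisfy the signed
  circuit axioms: nonzero, symmetric, incomparable supports, and (weak) elimination.
\<close>

definition oriented_matroid :: "'e set \<Rightarrow> ('e \<Rightarrow> int) set \<Rightarrow> bool" where
  "oriented_matroid E D \<longleftrightarrow>
     finite E \<and> D \<subseteq> sign_vectors E \<and>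
     (\<forall>X\<in>D. sv_support X \<noteq> {}) \<and>
     (\<forall>X\<in>D. - X \<in> D) \<and>
     (\<forall>X\<in>D. \<forall>Y\<in>D. sv_support X \<subseteq> sv_support Y \<longrightarrow> X = Y \<or> X = - Y) \<and>
     (\<forall>X\<in>D. \<forall>Y\<in>D. X \<noteq> - Y \<longrightarrow>
        (\<forall>e \<in> pos_part X \<inter> neg_part Y. \<exists>Z\<in>D.
           pos_part Z \<subseteq> (pos_part X \<union> pos_part Y) - {e} \<and>
           neg_part Z \<subseteq> (neg_part X \<union> neg_part Y) - {e}))"

text \<open>
  The complements of the supports of cocircuits are the hyperplanes of the underlying matroid. Hence
  a set spans iff it meets the support of every cocircuit, and the rank is the least size of a
  spanning set.
\<close>

definition om_spanning :: "'e set \<Rightarrow> ('e \<Rightarrow> int) set \<Rightarrow> 'e set \<Rightarrow> bool" where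
  "om_spanning E D A \<longleftrightarrow> A \<subseteq> E \<and> (\<forall>C\<in>D. A \<inter> sv_support C \<noteq> {})"

definition om_rank :: "'e set \<Rightarrow> ('e \<Rightarrow> int) set \<Rightarrow> nat" where
  "om_rank E D = (LEAST k. \<exists>A. om_spanning E D A \<and> card A = k)"

text \<open>
  The oriented matroid of a configuration \<open>V\<close> of (distinct) vectors, with ground set \<open>V\<close>: its
  covectors are the sign patterns on \<open>V\<close> of linear functionals, and its cocircuits are the nonzero
  covectors of minimal support.
\<close>

definition sign_of :: "real \<Rightarrow> int" where
  "sign_of x = (if x > 0 then 1 else if x < 0 then - 1 else 0)"

definition config_covector :: "'a::real_inner set \<Rightarrow> 'a \<Rightarrow> ('a \<Rightarrow> int)" where
  "config_covector V y = (\<lambda>v. if v \<in> V then sign_of (y \<bullet> v) else 0)"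

definition config_cocircuits :: "'a::real_inner set \<Rightarrow> ('a \<Rightarrow> int) set" where
  "config_cocircuits V = minimal_sign_vectors (range (config_covector V))"


section \<open>One-element extensions and localizations\<close>

text \<open>
  The ground set \<open>E \<squnion> {p}\<close> is encoded in the option type: \<open>Some e\<close> is the old element \<open>e\<close> and
  \<open>None\<close> is \<open>p\<close>.
\<close>

definition ext_ground :: "'e set \<Rightarrow> 'e option set" where
  "ext_ground E = insert None (Some ` E)"

text \<open>
  The cocircuits of the restriction to \<open>E\<close> (the deletion of \<open>p\<close>) are the nonzero vectors of minimal
  support among the restrictions of the cocircuits to \<open>E\<close>.
\<close>

definition restrict_to_old :: "('e option \<Rightarrow> int) set \<Rightarrow> ('e \<Rightarrow> int) set" where
  "restrict_to_old D' = minimal_sign_vectors ((\<lambda>Y. Y \<circ> Some) ` D')"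

definition one_element_extensions ::
  "'e set \<Rightarrow> ('e \<Rightarrow> int) set \<Rightarrow> ('e option \<Rightarrow> int) set set" where
  "one_element_extensions E D =
     {D'. oriented_matroid (ext_ground E) D' \<and>
          om_rank (ext_ground E) D' = om_rank E D \<and>
          restrict_to_old D' = D}"

text \<open>
  \<open>adjoin_sign C s\<close> agrees with \<open>C\<close> on \<open>E\<close> and has the value \<open>s\<close> at \<open>p\<close>.
\<close>

definition adjoin_sign :: "('e \<Rightarrow> int) \<Rightarrow> int \<Rightarrow> ('e option \<Rightarrow> int)" where
  "adjoin_sign C s = case_option s C"

definition localization_extension ::
  "'e set \<Rightarrow> ('e \<Rightarrow> int) set \<Rightarrow> (('e \<Rightarrow> int) \<Rightarrow> int) \<Rightarrow> ('e option \<Rightarrow> int) set \<Rightarrow> bool" where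
  "localization_extension E D \<sigma> D' \<longleftrightarrow>
     D' \<in> one_element_extensions E D \<and> (\<forall>C\<in>D. adjoin_sign C (\<sigma> C) \<in> D')"

definition is_localization ::
  "'e set \<Rightarrow> ('e \<Rightarrow> int) set \<Rightarrow> (('e \<Rightarrow> int) \<Rightarrow> int) \<Rightarrow> bool" where
  "is_localization E D \<sigma> \<longleftrightarrow> (\<exists>D'. localization_extension E D \<sigma> D')"

text \<open>
  The extension determined by a localization; it is uniquely determined by \<open>\<sigma>\<close>.
\<close>

definition extension_of ::
  "'e set \<Rightarrow> ('e \<Rightarrow> int) set \<Rightarrow> (('e \<Rightarrow> int) \<Rightarrow> int) \<Rightarrow> ('e option \<Rightarrow> int) set" where
  "extension_of E D \<sigma> = (THE D'. localization_extension E D \<sigma> D')"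


section \<open>The root configuration\<close>

text \<open>
  The finite linearly ordered index type \<open>'n\<close> plays the role of \<open>[n]\<close> with \<open>n = CARD('n) \<ge> 1\<close>.
\<close>

definition B_config :: "(real, 'n::{finite,linorder}) vec set" where
  "B_config =
     {axis i 1 | i. True} \<union>
     {axis i 1 - axis j 1 | i j. i < j} \<union>
     {axis i 1 + axis j 1 | i j. i < j}"

definition B_cocircuits :: "((real, 'n::{finite,linorder}) vec \<Rightarrow> int) set" where
  "B_cocircuits = config_cocircuits B_config"

text \<open>
  \<open>represents X C\<close> says that \<open>C\<close> is the cocircuit corresponding to the sign vector \<open>X\<close> on \<open>[n]\<close>.
\<close>

definition represents ::
  "('n::{finite,linorder} \<Rightarrow> int) \<Rightarrow> ((real, 'n) vec \<Rightarrow> int) \<Rightarrow> bool" where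
  "represents X C \<longleftrightarrow>
     (\<forall>i. C (axis i 1) = X i) \<and>
     (\<forall>i j. i < j \<longrightarrow> C (axis i 1 + axis j 1) = sgn (X i + X j) \<and>
                      C (axis i 1 - axis j 1) = sgn (X i - X j))"


section \<open>Generalized partial term orders\<close>

definition generalized_partial_term_order :: "('n set \<Rightarrow> 'n set \<Rightarrow> bool) \<Rightarrow> bool" where
  "generalized_partial_term_order prec \<longleftrightarrow>
     irreflp prec \<and> transp prec \<and>
     (\<forall>\<alpha> \<beta> \<gamma>. \<gamma> \<inter> (\<alpha> \<union> \<beta>) = {} \<longrightarrow> (prec \<alpha> \<beta> \<longleftrightarrow> prec (\<alpha> \<union> \<gamma>) (\<beta> \<union> \<gamma>))) \<and>
     (\<forall>\<alpha> \<beta>. \<not> prec \<alpha> \<beta> \<and> \<not> prec \<beta> \<alpha> \<longrightarrow>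
        {\<gamma>. prec \<gamma> \<alpha>} = {\<gamma>. prec \<gamma> \<beta>} \<and> {\<gamma>. prec \<alpha> \<gamma>} = {\<gamma>. prec \<beta> \<gamma>})"

definition order_sign :: "('n set \<Rightarrow> 'n set \<Rightarrow> bool) \<Rightarrow> ('n \<Rightarrow> int) \<Rightarrow> int" where
  "order_sign prec X =
     (if prec (neg_part X) (pos_part X) then 1
      else if prec (pos_part X) (neg_part X) then - 1
      else 0)"

definition induced_sign ::
  "('n::{finite,linorder} set \<Rightarrow> 'n set \<Rightarrow> bool) \<Rightarrow> ((real, 'n) vec \<Rightarrow> int) \<Rightarrow> int" where
  "induced_sign prec C =
     order_sign prec (THE X. X \<in> sign_vectors UNIV \<and> sv_support X \<noteq> {} \<and> represents X C)"

definition order_extension ::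
  "('n::{finite,linorder} set \<Rightarrow> 'n set \<Rightarrow> bool) \<Rightarrow> ((real, 'n) vec option \<Rightarrow> int) set" where
  "order_extension prec = extension_of B_config B_cocircuits (induced_sign prec)"

end

theory Submission
  imports Defs "HOL-Library.Function_Algebras"
begin

text \<open>
  The sign function \<open>m = \<mu>\<^sub>\<prec>\<close> is odd, and whenever \<open>x\<close>, \<open>y\<close>, \<open>x + y\<close> are all sign vectors,
  \<open>m x \<ge> 0\<close> and \<open>m y \<ge> 0\<close> give \<open>m (x + y) \<ge> 0\<close> (strictly if \<open>m y > 0\<close>), by moving along a chain
  of three subsets. Nothing else about \<open>\<prec>\<close> is needed for the extension. Following Las Vergnas, its
  cocircuits are the \<open>(X, m X)\<close> together with the vectors that vanish at \<open>p\<close> and come from the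
  edges \<open>x \<le> y\<close> of the Coxeter complex with \<open>m x = - m y \<noteq> 0\<close>; such an edge is represented by
  the integer vector \<open>x + y\<close> in its interior.

  Elimination reduces to vertices: if \<open>m x, m y \<ge> 0\<close> and a root \<open>v\<close> separates \<open>x\<close> from \<open>y\<close>, one of
  a few explicit sign vectors \<open>w\<close> on \<open>v = 0\<close> in the conformal hull of \<open>x\<close> and \<open>y\<close> has \<open>m w \<ge> 0\<close>,
  because otherwise additivity of \<open>m\<close> is violated. The zeros of \<open>m\<close> are found by following a
  path of five vertices from \<open>x\<close> to \<open>y\<close>. Conversely, any extension inducing \<open>m\<close> must contain
  every edge cocircuit, and two extensions of the same oriented matroid that are comparable by
  inclusion coincide; so \<open>m\<close>, which determines \<open>\<prec>\<close>, determines the extension.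
\<close>

section \<open>Roots and sign vectors\<close>

definition ternary :: "('n \<Rightarrow> int) \<Rightarrow> bool" where
  "ternary x \<longleftrightarrow> (\<forall>i. x i = - 1 \<or> x i = 0 \<or> x i = 1)"

text \<open>
  Roots have integral coordinates, so the floor is exact and the pairing of a root with an integer
  vector stays in the integers.
\<close>

definition root_eval :: "(real, 'n::finite) vec \<Rightarrow> ('n \<Rightarrow> int) \<Rightarrow> int" where
  "root_eval v x = (\<Sum>i\<in>UNIV. \<lfloor>v $ i\<rfloor> * x i)"

definition root_pattern :: "('n::{finite,linorder} \<Rightarrow> int) \<Rightarrow> (real, 'n) vec \<Rightarrow> int" where
  "root_pattern x = (\<lambda>v. if v \<in> B_config then sgn (root_eval v x) else 0)"

lemma ternaryD: "ternary x \<Longrightarrow> x i = - 1 \<or> x i = 0 \<or> x i = 1"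
  by (simp add: ternary_def)

lemma floor_minus_one: "\<lfloor>- 1 :: real\<rfloor> = - 1"
  by (simp add: floor_eq_iff)

lemma root_eval_add: "root_eval v (x + y) = root_eval v x + root_eval v y"
  by (simp add: root_eval_def distrib_left sum.distrib)

lemma root_eval_uminus: "root_eval v (- x) = - root_eval v x"
  by (simp add: root_eval_def sum_negf)

lemma root_eval_axis: "root_eval (axis i 1) x = x i"
proof -
  have "root_eval (axis i 1) x = (\<Sum>k\<in>UNIV. if k = i then x k else 0)"
    unfolding root_eval_def by (intro sum.cong) (auto simp: axis_def)
  then show ?thesis by simp
qed

lemma root_eval_axis_plus:
  assumes "i \<noteq> j" shows "root_eval (axis i 1 + axis j 1) x = x i + x j"
proof -
  have "root_eval (axis i 1 + axis j 1) x
      = (\<Sum>k\<in>UNIV. (if k = i then x k else 0) + (if k = j then x k else 0))"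
    unfolding root_eval_def using assms
    by (intro sum.cong) (auto simp: axis_def floor_minus_one)
  then show ?thesis by (simp add: sum.distrib)
qed

lemma root_eval_axis_minus:
  assumes "i \<noteq> j" shows "root_eval (axis i 1 - axis j 1) x = x i - x j"
proof -
  have "root_eval (axis i 1 - axis j 1) x
      = (\<Sum>k\<in>UNIV. (if k = i then x k else 0) - (if k = j then x k else 0))"
    unfolding root_eval_def using assms
    by (intro sum.cong) (auto simp: axis_def floor_minus_one)
  then show ?thesis by (simp add: sum_subtractf)
qed

lemma B_config_cases:
  assumes "v \<in> B_config"
  obtains (single) i where "v = axis i 1"
  | (minus) i j where "i < j" "v = axis i 1 - axis j 1"
  | (plus) i j where "i < j" "v = axis i 1 + axis j 1"
  using assms unfolding B_config_def by auto

text \<open>One formula covers the three kinds of roots, for integer and real vectors at once;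
  \<open>c = 0\<close> gives the roots \<open>axis i 1\<close>, and then \<open>j\<close> is a
  dummy.\<close>

lemma root_eval_inner_form:
  assumes "v \<in> B_config"
  obtains i j c where "c = - 1 \<or> c = 0 \<or> c = 1" "\<And>x. root_eval v x = x i + c * x j"
    "\<And>y. y \<bullet> v = y $ i + real_of_int c * y $ j"
  using assms
proof (cases rule: B_config_cases)
  case (single i)
  then show thesis by (intro that[of 0 i i]) (auto simp: root_eval_axis inner_axis)
next
  case (minus i j)
  then show thesis
    by (intro that[of "- 1" i j]) (auto simp: root_eval_axis_minus inner_axis inner_diff_right)
next
  case (plus i j)
  then show thesis
    by (intro that[of 1 i j]) (auto simp: root_eval_axis_plus inner_axis inner_add_right)
qed

lemma root_eval_form:
  assumes "v \<in> B_config"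
  shows "\<exists>i j c. (c = - 1 \<or> c = 0 \<or> c = 1) \<and> (\<forall>x. root_eval v x = x i + c * x j)"
  using assms by (rule root_eval_inner_form) blast

lemma B_config_single: "axis i 1 \<in> B_config"
  by (auto simp: B_config_def)

lemma B_config_plus: "i < j \<Longrightarrow> axis i 1 + axis j 1 \<in> B_config"
  unfolding B_config_def by blast

lemma B_config_minus: "i < j \<Longrightarrow> axis i 1 - axis j 1 \<in> B_config"
  unfolding B_config_def by blast

lemma finite_B_config: "finite B_config"
proof -
  have "B_config \<subseteq> range (\<lambda>i. axis i 1) \<union> range (\<lambda>(i, j). axis i 1 - axis j 1)
      \<union> range (\<lambda>(i, j). axis i (1::real) + axis j 1 :: (real, 'a) vec)"
    unfolding B_config_def by auto
  then show ?thesis by (rule finite_subset) auto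
qed

text \<open>The roots vanishing at \<open>b\<close> record which coordinates of \<open>b\<close> are
  zero, equal or opposite, and \<open>a\<close> inherits each of these relations.\<close>

lemma root_eval_zero_imp:
  assumes "\<forall>v\<in>B_config. root_eval v b = 0 \<longrightarrow> root_eval v a = 0"
  shows "b i = 0 \<Longrightarrow> a i = 0" and "b i = b j \<Longrightarrow> a i = a j" and "b i = - b j \<Longrightarrow> a i = - a j"
proof -
  have z: "a i = 0" if "b i = 0" for i
    using bspec[OF assms B_config_single, of i] that by (simp add: root_eval_axis)
  have m: "a i = a j" if "b i = b j" "i < j" for i j
    using bspec[OF assms B_config_minus, OF that(2)] that by (simp add: root_eval_axis_minus)
  have p: "a i = - a j" if "b i = - b j" "i < j" for i j
    using bspec[OF assms B_config_plus, OF that(2)] that by (simp add: root_eval_axis_plus)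
  show "b i = 0 \<Longrightarrow> a i = 0" by (rule z)
  show "a i = a j" if "b i = b j"
    using m[of i j] m[of j i] that by (metis linorder_neq_iff)
  show "a i = - a j" if "b i = - b j"
  proof (cases "i = j")
    case True
    then show ?thesis using z[of i] that by simp
  next
    case False
    then show ?thesis using p[of i j] p[of j i] that by (metis linorder_neq_iff minus_minus)
  qed
qed

lemma ternary_uminus: "ternary x \<Longrightarrow> ternary (- x)"
  unfolding ternary_def by (metis fun_Compl_def add.inverse_inverse neg_equal_0_iff_equal)

lemma root_pattern_uminus: "root_pattern (- x) = - root_pattern x"
  by (simp add: fun_eq_iff root_pattern_def root_eval_uminus)

lemma root_pattern_inj:
  assumes "ternary x" "ternary y" "root_pattern x = root_pattern y" shows "x = y"
proof
  fix i
  have "sgn (x i) = sgn (y i)"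
    using fun_cong[OF assms(3), of "axis i 1"]
    by (simp add: root_pattern_def B_config_single root_eval_axis)
  then show "x i = y i" using ternaryD[OF assms(1), of i] ternaryD[OF assms(2), of i] by auto
qed

text \<open>All nonzero coordinates of \<open>b\<close> agree up to sign, so the inherited relations
  make \<open>a\<close> a multiple of \<open>b\<close>, with factor \<open>a i * b i\<close> for any
  \<open>i\<close> in the support of \<open>b\<close>. As \<open>a\<close> is a nonzero sign vector,
  the factor is 1 or -1.\<close>

lemma root_support_ternary:
  assumes "ternary b" "b \<noteq> 0" "ternary a" "a \<noteq> 0"
    "\<forall>v\<in>B_config. root_eval v b = 0 \<longrightarrow> root_eval v a = 0"
  shows "a = b \<or> a = - b"
proof -
  note r = root_eval_zero_imp[OF assms(5)]
  obtain i where i: "b i \<noteq> 0" using assms(2) by (auto simp: fun_eq_iff)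
  have bi: "b i * b i = 1" using i ternaryD[OF assms(1), of i] by auto
  have k: "a j = (a i * b i) * b j" for j
  proof -
    consider "b j = 0" | "b j = b i" | "b j = - b i"
      using i ternaryD[OF assms(1), of i] ternaryD[OF assms(1), of j] by linarith
    then show ?thesis
    proof cases
      case 1 then show ?thesis using r(1)[of j] by simp
    next
      case 2 then show ?thesis unfolding 2 r(2)[OF 2] mult.assoc bi by simp
    next
      case 3 then show ?thesis unfolding 3 r(3)[OF 3] by (simp add: mult.assoc bi)
    qed
  qed
  have "a i \<noteq> 0"
  proof
    assume "a i = 0"
    then have "a j = 0" for j using k[of j] by simp
    then show False using assms(4) by (auto simp: fun_eq_iff)
  qed
  then have "a i * b i = 1 \<or> a i * b i = - 1"
    using i ternaryD[OF assms(1), of i] ternaryD[OF assms(3), of i] by auto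
  then show ?thesis
  proof
    assume h: "a i * b i = 1"
    have "a j = b j" for j using k[of j] unfolding h by simp
    then show ?thesis by (auto simp: fun_eq_iff)
  next
    assume h: "a i * b i = - 1"
    have "a j = - b j" for j using k[of j] unfolding h by simp
    then show ?thesis by (auto simp: fun_eq_iff)
  qed
qed

section \<open>The conformal hull of two vectors\<close>

text \<open>This is the sign condition that cocircuit elimination puts on the resulting vector, read
  off at the roots only.\<close>

definition between :: "('n::{finite,linorder} \<Rightarrow> int) \<Rightarrow> ('n \<Rightarrow> int) \<Rightarrow> ('n \<Rightarrow> int) \<Rightarrow> bool" where
  "between x y w \<longleftrightarrow> (\<forall>v\<in>B_config.
     (root_eval v w > 0 \<longrightarrow> root_eval v x > 0 \<or> root_eval v y > 0) \<and>
     (root_eval v w < 0 \<longrightarrow> root_eval v x < 0 \<or> root_eval v y < 0))"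

lemma between_left: "between x y x" and between_right: "between x y y"
  by (auto simp: between_def)

lemma between_add: "between x y w \<Longrightarrow> between x y z \<Longrightarrow> between x y (w + z)"
  unfolding between_def root_eval_add by (smt (verit))

lemma between_trans: "between a b x \<Longrightarrow> between a b y \<Longrightarrow> between x y w \<Longrightarrow> between a b w"
  unfolding between_def by blast

lemma between_self: "between x x w \<Longrightarrow> between x y w" "between y y w \<Longrightarrow> between x y w"
  unfolding between_def by blast+

lemma between_zero:
  "between x y w \<Longrightarrow> v \<in> B_config \<Longrightarrow> root_eval v x = 0 \<Longrightarrow> root_eval v y = 0 \<Longrightarrow> root_eval v w = 0"
  unfolding between_def by (smt (verit))

text \<open>A root compares \<open>x i\<close> with \<open>- (c * x j)\<close>. If it is positive at
  neither \<open>x\<close> nor \<open>y\<close>, monotonicity of \<open>\<phi>\<close> carries both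
  comparisons over to the new vector, and oddness lets \<open>c\<close> pass through
  \<open>\<phi>\<close>. The negative case is symmetric.\<close>

lemma between_pointwise:
  fixes \<phi> :: "int \<Rightarrow> int \<Rightarrow> int"
  assumes x: "ternary x" and y: "ternary y"
    and mono: "\<forall>a\<in>{- 1, 0, 1}. \<forall>b\<in>{- 1, 0, 1}. \<forall>a'\<in>{- 1, 0, 1}. \<forall>b'\<in>{- 1, 0, 1}.
      a \<le> a' \<longrightarrow> b \<le> b' \<longrightarrow> \<phi> a b \<le> \<phi> a' b'"
    and odd: "\<forall>a\<in>{- 1, 0, 1}. \<forall>b\<in>{- 1, 0, 1}. \<phi> (- a) (- b) = - \<phi> a b"
  shows "between x y (\<lambda>i. \<phi> (x i) (y i))"
  unfolding between_def
proof (intro ballI)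
  fix v :: "(real, 'a) vec" assume v: "v \<in> B_config"
  obtain i j c where c: "c = - 1 \<or> c = 0 \<or> c = 1" and e: "\<And>x. root_eval v x = x i + c * x j"
    using root_eval_form[OF v] by blast
  have tern: "a i \<in> {- 1, 0, 1}" "c * a j \<in> {- 1, 0, 1}" "- (c * a j) \<in> {- 1, 0, 1}" if "ternary a" for a
  proof -
    show "a i \<in> {- 1, 0, 1}" using ternaryD[OF that, of i] by simp
    have "c * a j = - 1 \<or> c * a j = 0 \<or> c * a j = 1"
      using c ternaryD[OF that, of j] by (elim disjE) simp_all
    then show "c * a j \<in> {- 1, 0, 1}" "- (c * a j) \<in> {- 1, 0, 1}" by (elim disjE; simp)+
  qed
  note t = tern(1)[OF x] tern(1)[OF y] tern(2)[OF x] tern(2)[OF y] tern(3)[OF x] tern(3)[OF y]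
  have z: "\<phi> 0 0 = 0" using odd by simp
  have c\<phi>: "\<phi> (- (c * x j)) (- (c * y j)) = - (c * \<phi> (x j) (y j))"
  proof -
    have "\<phi> (- x j) (- y j) = - \<phi> (x j) (y j)"
      using odd ternaryD[OF x, of j] ternaryD[OF y, of j] by blast
    then show ?thesis using c z by (elim disjE) simp_all
  qed
  have m1: "\<phi> (x i) (y i) \<le> \<phi> (- (c * x j)) (- (c * y j))"
    if "x i \<le> - (c * x j)" "y i \<le> - (c * y j)"
    using mono t that by blast
  have m2: "\<phi> (- (c * x j)) (- (c * y j)) \<le> \<phi> (x i) (y i)"
    if "- (c * x j) \<le> x i" "- (c * y j) \<le> y i"
    using mono t that by blast
  show "(root_eval v (\<lambda>i. \<phi> (x i) (y i)) > 0 \<longrightarrow> root_eval v x > 0 \<or> root_eval v y > 0) \<and>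
     (root_eval v (\<lambda>i. \<phi> (x i) (y i)) < 0 \<longrightarrow> root_eval v x < 0 \<or> root_eval v y < 0)"
    unfolding e using m1 m2 c\<phi> by linarith
qed

section \<open>Comparable sign vectors: the edges of the Coxeter complex\<close>

definition conformal_le :: "('n \<Rightarrow> int) \<Rightarrow> ('n \<Rightarrow> int) \<Rightarrow> bool" where
  "conformal_le x y \<longleftrightarrow> (\<forall>i. x i \<noteq> 0 \<longrightarrow> y i = x i)"

lemma conformal_le_not_opposite:
  assumes "conformal_le x y" "x \<noteq> 0" shows "x \<noteq> - y"
proof
  assume e: "x = - y"
  obtain i where i: "x i \<noteq> 0" using assms(2) by (auto simp: fun_eq_iff)
  then have "y i = x i" using assms(1) by (simp add: conformal_le_def)
  moreover have "x i = - y i" using e by simp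
  ultimately show False using i by simp
qed

text \<open>No root separates comparable sign vectors: nonzero coordinates of \<open>x\<close>
  persist in \<open>y\<close>, and a new coordinate of \<open>y\<close> shifts a positive value,
  which is at least 1, by at most 1.\<close>

lemma conformal_root_eval:
  assumes "ternary x" "ternary y" "conformal_le x y" "v \<in> B_config"
  shows "root_eval v x > 0 \<Longrightarrow> root_eval v y \<ge> 0" and "root_eval v x < 0 \<Longrightarrow> root_eval v y \<le> 0"
proof -
  obtain i j c where c: "c = - 1 \<or> c = 0 \<or> c = 1" and e: "\<And>x. root_eval v x = x i + c * x j"
    using root_eval_form[OF assms(4)] by blast
  have d: "x i = 0 \<or> y i = x i" "x j = 0 \<or> y j = x j"
    using assms(3) by (auto simp: conformal_le_def)
  have t: "\<bar>x i\<bar> \<le> 1" "\<bar>x j\<bar> \<le> 1" "\<bar>y i\<bar> \<le> 1" "\<bar>y j\<bar> \<le> 1"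
    using ternaryD[OF assms(1), of i] ternaryD[OF assms(1), of j]
      ternaryD[OF assms(2), of i] ternaryD[OF assms(2), of j] by linarith+
  have "(root_eval v x > 0 \<longrightarrow> root_eval v y \<ge> 0) \<and> (root_eval v x < 0 \<longrightarrow> root_eval v y \<le> 0)"
    using c
  proof (elim disjE)
    assume "c = - 1" then show ?thesis using d t unfolding e by simp linarith
  next
    assume "c = 0" then show ?thesis using d t unfolding e by simp linarith
  next
    assume "c = 1" then show ?thesis using d t unfolding e by simp linarith
  qed
  then show "root_eval v x > 0 \<Longrightarrow> root_eval v y \<ge> 0" "root_eval v x < 0 \<Longrightarrow> root_eval v y \<le> 0"
    by blast+
qed

text \<open>As no root has opposite strict signs at \<open>x\<close> and \<open>y\<close>, nothing
  cancels in the sum.\<close>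

lemma between_conformal_sum:
  assumes "ternary x" "ternary y" "conformal_le x y"
  shows "between (x + y) (x + y) x" "between (x + y) (x + y) y"
  using conformal_root_eval[OF assms] unfolding between_def root_eval_add by (smt (verit))+

section \<open>Rounding integer vectors to sign vectors by a threshold\<close>

definition cut :: "int \<Rightarrow> int \<Rightarrow> int" where
  "cut t a = (if \<bar>a\<bar> \<ge> t then sgn a else 0)"

lemma cut_uminus: "cut t (- a) = - cut t a"
  by (simp add: cut_def)

lemma cut_mono: "t \<ge> 1 \<Longrightarrow> a \<le> b \<Longrightarrow> cut t a \<le> cut t b"
  by (simp add: cut_def sgn_if)

text \<open>The threshold is the larger of the two absolute values: the number attaining it keeps
  its sign, while the other is rounded to zero or, if it has the same absolute value, to the
  opposite sign.\<close>

lemma cut_separates: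
  assumes "a < b" shows "\<exists>t\<ge>1. cut t a < cut t b"
proof (cases "b > 0 \<and> \<bar>a\<bar> \<le> b")
  case True
  then show ?thesis using assms by (intro exI[of _ b]) (simp add: cut_def sgn_if)
next
  case False
  then show ?thesis using assms by (intro exI[of _ "- a"]) (smt (verit) cut_def sgn_if)
qed

lemma ternary_cut: "ternary (\<lambda>i. cut t (w i))"
  by (simp add: ternary_def cut_def sgn_if)

text \<open>Rounding is odd and monotone, so it respects the comparison of \<open>w i\<close> with
  \<open>- (c * w j)\<close> that a root makes.\<close>

lemma between_cut:
  assumes "t \<ge> 1" shows "between w w (\<lambda>i. cut t (w i))"
  unfolding between_def
proof (intro ballI)
  fix v :: "(real, 'a) vec" assume v: "v \<in> B_config"
  obtain i j c where c: "c = - 1 \<or> c = 0 \<or> c = 1" and e: "\<And>x. root_eval v x = x i + c * x j"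
    using root_eval_form[OF v] by blast
  have c': "c * cut t (w j) = cut t (c * w j)"
    using c cut_uminus[of t "w j"] by (auto simp: cut_def)
  show "(root_eval v (\<lambda>i. cut t (w i)) > 0 \<longrightarrow> root_eval v w > 0 \<or> root_eval v w > 0) \<and>
     (root_eval v (\<lambda>i. cut t (w i)) < 0 \<longrightarrow> root_eval v w < 0 \<or> root_eval v w < 0)"
    unfolding e c' using cut_mono[OF assms, of "w i" "- (c * w j)"]
      cut_mono[OF assms, of "- (c * w j)" "w i"] cut_uminus[of t "c * w j"] by linarith
qed

lemma cut_root_eval_pos:
  assumes "v \<in> B_config" "root_eval v w > 0"
  shows "\<exists>t\<ge>1. root_eval v (\<lambda>i. cut t (w i)) > 0"
proof -
  obtain i j c where c: "c = - 1 \<or> c = 0 \<or> c = 1" and e: "\<And>x. root_eval v x = x i + c * x j"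
    using root_eval_form[OF assms(1)] by blast
  have "- (c * w j) < w i" using assms(2) e[of w] by simp
  then obtain t where t: "t \<ge> 1" "cut t (- (c * w j)) < cut t (w i)"
    using cut_separates by blast
  have "c * cut t (w j) = cut t (c * w j)"
    using c cut_uminus[of t "w j"] by (auto simp: cut_def)
  then show ?thesis using t cut_uminus[of t "c * w j"] by (intro exI[of _ t]) (simp add: e)
qed

section \<open>Additive sign functions\<close>

locale sign_order =
  fixes m :: "('n::{finite,linorder} \<Rightarrow> int) \<Rightarrow> int"
  assumes m_range: "m x = - 1 \<or> m x = 0 \<or> m x = 1"
    and m_uminus: "ternary x \<Longrightarrow> m (- x) = - m x"
    and m_add: "\<lbrakk>ternary x; ternary y; ternary (x + y); m x \<ge> 0; m y \<ge> 0\<rbrakk> \<Longrightarrow> m (x + y) \<ge> 0"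
    and m_add_strict:
      "\<lbrakk>ternary x; ternary y; ternary (x + y); m x \<ge> 0; m y > 0\<rbrakk> \<Longrightarrow> m (x + y) > 0"
begin

text \<open>The remaining sign combinations follow from the axioms by commuting the summands and
  passing to negatives. The sum enters as an equation so that \<open>z\<close> may be given in any
  form.\<close>

lemma m_add_eq:
  assumes "ternary x" "ternary y" "z = x + y" "ternary z"
  shows "m x \<ge> 0 \<Longrightarrow> m y \<ge> 0 \<Longrightarrow> m z \<ge> 0"
    and "m x > 0 \<Longrightarrow> m y \<ge> 0 \<Longrightarrow> m z > 0"
    and "m x \<ge> 0 \<Longrightarrow> m y > 0 \<Longrightarrow> m z > 0"
    and "m x \<le> 0 \<Longrightarrow> m y \<le> 0 \<Longrightarrow> m z \<le> 0"
    and "m x < 0 \<Longrightarrow> m y \<le> 0 \<Longrightarrow> m z < 0"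
    and "m x \<le> 0 \<Longrightarrow> m y < 0 \<Longrightarrow> m z < 0"
proof -
  have u: "- z = - x + - y" "- z = - y + - x" "z = y + x"
    using assms(3) by (simp_all add: fun_eq_iff)
  note t = assms(1,2,4) ternary_uminus[OF assms(1)] ternary_uminus[OF assms(2)]
    ternary_uminus[OF assms(4)]
  note n = m_uminus[OF assms(1)] m_uminus[OF assms(2)] m_uminus[OF assms(4)]
  show "m x \<ge> 0 \<Longrightarrow> m y \<ge> 0 \<Longrightarrow> m z \<ge> 0"
    using m_add[of x y, folded assms(3)] t by blast
  show "m x \<ge> 0 \<Longrightarrow> m y > 0 \<Longrightarrow> m z > 0"
    using m_add_strict[of x y, folded assms(3)] t by blast
  show "m x > 0 \<Longrightarrow> m y \<ge> 0 \<Longrightarrow> m z > 0"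
    using m_add_strict[of y x, folded u(3)] t by blast
  show "m x \<le> 0 \<Longrightarrow> m y \<le> 0 \<Longrightarrow> m z \<le> 0"
    using m_add[of "- x" "- y", folded u(1)] t n by simp
  show "m x \<le> 0 \<Longrightarrow> m y < 0 \<Longrightarrow> m z < 0"
    using m_add_strict[of "- x" "- y", folded u(1)] t n by simp
  show "m x < 0 \<Longrightarrow> m y \<le> 0 \<Longrightarrow> m z < 0"
    using m_add_strict[of "- y" "- x", folded u(2)] t n by simp
qed

lemma m_zero: "m 0 = 0"
  using m_uminus[of 0] by (simp add: ternary_def)

text \<open>This transfers results about nonnegative values to nonpositive ones.\<close>

lemma sign_order_uminus: "sign_order (\<lambda>x. - m x)"
proof
  fix x y :: "'n \<Rightarrow> int"
  show "- m x = - 1 \<or> - m x = 0 \<or> - m x = 1" using m_range[of x] by auto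
  show "ternary x \<Longrightarrow> - m (- x) = - (- m x)" using m_uminus by simp
  show "\<lbrakk>ternary x; ternary y; ternary (x + y); - m x \<ge> 0; - m y \<ge> 0\<rbrakk> \<Longrightarrow> - m (x + y) \<ge> 0"
    using m_add_eq(4)[of x y "x + y"] by simp
  show "\<lbrakk>ternary x; ternary y; ternary (x + y); - m x \<ge> 0; - m y > 0\<rbrakk> \<Longrightarrow> - m (x + y) > 0"
    using m_add_eq(6)[of x y "x + y"] by simp
qed

end

text \<open>For this sign function \<open>vertex_elimination\<close> becomes elimination in the root
  configuration alone, which serves when the new element imposes no condition.\<close>

lemma sign_order_zero: "sign_order (\<lambda>x. 0)"
  by unfold_locales auto

text \<open>
  Relative to sign vectors \<open>x\<close>, \<open>y\<close>, let \<open>Q\<close>, \<open>A\<close>, \<open>B\<close>, \<open>S\<close> be the parts where \<open>x = y\<close>, \<open>y = 0\<close>,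
  \<open>x = 0\<close>, \<open>x = - y\<close>, with \<open>S\<close> signed as in \<open>y\<close>. Then \<open>x = Q + A - S\<close> and \<open>y = Q + B + S\<close>, and
  \<open>mix x y p q r s = p Q + q A + r B + s S\<close>.
\<close>

definition mix1 :: "int \<Rightarrow> int \<Rightarrow> int \<Rightarrow> int \<Rightarrow> int \<Rightarrow> int \<Rightarrow> int" where
  "mix1 a b p q r s = (if a = b then p * a else if b = 0 then q * a else if a = 0 then r * b else s * b)"

definition mix :: "('n \<Rightarrow> int) \<Rightarrow> ('n \<Rightarrow> int) \<Rightarrow> int \<Rightarrow> int \<Rightarrow> int \<Rightarrow> int \<Rightarrow> 'n \<Rightarrow> int" where
  "mix x y p q r s = (\<lambda>i. mix1 (x i) (y i) p q r s)"

lemma mix_left: "ternary x \<Longrightarrow> ternary y \<Longrightarrow> mix x y 1 1 0 (- 1) = x"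
proof
  fix i assume "ternary x" "ternary y"
  then show "mix x y 1 1 0 (- 1) i = x i"
    using ternaryD[of x i] ternaryD[of y i] by (auto simp: mix_def mix1_def)
qed

lemma mix_right: "mix x y 1 0 1 1 = y"
  by (auto simp: mix_def mix1_def fun_eq_iff)

lemma mix_add: "mix x y p q r s + mix x y p' q' r' s' = mix x y (p + p') (q + q') (r + r') (s + s')"
  by (auto simp: mix_def mix1_def fun_eq_iff distrib_right)

lemma mix_uminus: "- mix x y p q r s = mix x y (- p) (- q) (- r) (- s)"
  by (auto simp: mix_def mix1_def fun_eq_iff)

lemma ternary_mult: "(p::int) \<in> {- 1, 0, 1} \<Longrightarrow> a = - 1 \<or> a = 0 \<or> a = 1
    \<Longrightarrow> p * a = - 1 \<or> p * a = 0 \<or> p * a = 1"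
  by auto

lemma ternary_mix:
  assumes "ternary x" "ternary y" "p \<in> {- 1, 0, 1}" "q \<in> {- 1, 0, 1}" "r \<in> {- 1, 0, 1}" "s \<in> {- 1, 0, 1}"
  shows "ternary (mix x y p q r s)"
  unfolding ternary_def
proof
  fix i
  note t = ternaryD[OF assms(1), of i] ternaryD[OF assms(2), of i]
  consider "mix x y p q r s i = p * x i" | "mix x y p q r s i = q * x i"
    | "mix x y p q r s i = r * y i" | "mix x y p q r s i = s * y i"
    unfolding mix_def mix1_def by presburger
  then show "mix x y p q r s i = - 1 \<or> mix x y p q r s i = 0 \<or> mix x y p q r s i = 1"
  proof cases
    case 1 show ?thesis unfolding 1 by (rule ternary_mult[OF assms(3) t(1)])
  next
    case 2 show ?thesis unfolding 2 by (rule ternary_mult[OF assms(4) t(1)])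
  next
    case 3 show ?thesis unfolding 3 by (rule ternary_mult[OF assms(5) t(2)])
  next
    case 4 show ?thesis unfolding 4 by (rule ternary_mult[OF assms(6) t(2)])
  qed
qed

text \<open>The six tuples are the candidates for elimination; for each of them the coordinate
  function is odd and monotone in both arguments.\<close>

lemma between_mix:
  assumes "ternary x" "ternary y"
    and w: "(p, q, r, s) \<in> {(1, 0, 0, 0), (1, 1, 0, 0), (1, 0, 1, 0), (1, 1, 1, 0), (1, 1, 1, - 1), (1, 1, 1, 1)}"
  shows "between x y (mix x y p q r s)"
proof -
  have "between x y (\<lambda>i. (\<lambda>a b. if a = b then p * a else if b = 0 then q * a
     else if a = 0 then r * b else s * b) (x i) (y i))"
    using w by (intro between_pointwise[OF assms(1,2)]; elim insertE emptyE; simp)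
  then show ?thesis by (simp add: mix_def mix1_def)
qed

lemma conformal_le_mix:
  assumes "p = 0 \<or> p' = p" "q = 0 \<or> q' = q" "r = 0 \<or> r' = r" "s = 0 \<or> s' = s"
  shows "conformal_le (mix x y p q r s) (mix x y p' q' r' s')"
  using assms by (auto simp: conformal_le_def mix_def mix1_def)

lemma mix_eq_0:
  assumes "ternary x" "ternary y" "p \<noteq> 0" "q \<noteq> 0" "r \<noteq> 0" "mix x y p q r s = 0"
  shows "x = - y" and "s \<noteq> 0 \<Longrightarrow> x = 0"
proof -
  have z: "mix x y p q r s i = 0" for i using assms(6) by (simp add: fun_eq_iff)
  have "x i = - y i" "s \<noteq> 0 \<Longrightarrow> x i = 0" for i
    using z[of i] assms(3-5) ternaryD[OF assms(1), of i] ternaryD[OF assms(2), of i]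
    by (auto simp: mix_def mix1_def split: if_splits)
  then show "x = - y" "s \<noteq> 0 \<Longrightarrow> x = 0" by (auto simp: fun_eq_iff)
qed

text \<open>A finite check over the coordinates that a separating root involves. Each alternative
  lists candidates on the hyperplane of the root, enough of them to contradict additivity in
  \<open>vertex_elimination\<close>.\<close>

lemma mix1_roots:
  "\<forall>c\<in>{- 1, 0, 1}. \<forall>a\<in>{- 1, 0, 1}. \<forall>a'\<in>{- 1, 0, 1}. \<forall>b\<in>{- 1, 0, 1}. \<forall>b'\<in>{- 1, 0, 1}.
    a + c * a' > 0 \<longrightarrow> b + c * b' < 0 \<longrightarrow>
    mix1 a b 1 1 0 0 + c * mix1 a' b' 1 1 0 0 = 0 \<and>
      mix1 a b 1 0 1 0 + c * mix1 a' b' 1 0 1 0 = 0 \<or>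
    mix1 a b 1 0 0 0 + c * mix1 a' b' 1 0 0 0 = 0 \<and>
      mix1 a b 1 1 1 0 + c * mix1 a' b' 1 1 1 0 = 0 \<or>
    mix1 a b 1 0 0 0 + c * mix1 a' b' 1 0 0 0 = 0 \<and>
      mix1 a b 1 1 0 0 + c * mix1 a' b' 1 1 0 0 = 0 \<and>
      mix1 a b 1 1 1 (- 1) + c * mix1 a' b' 1 1 1 (- 1) = 0 \<or>
    mix1 a b 1 0 0 0 + c * mix1 a' b' 1 0 0 0 = 0 \<and>
      mix1 a b 1 0 1 0 + c * mix1 a' b' 1 0 1 0 = 0 \<and>
      mix1 a b 1 1 1 1 + c * mix1 a' b' 1 1 1 1 = 0"
  by (intro ballI; elim insertE emptyE; hypsubst; simp add: mix1_def)

lemma mix_roots: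
  assumes "ternary x" "ternary y" "v \<in> B_config" "root_eval v x > 0" "root_eval v y < 0"
  obtains
    (opp) "root_eval v (mix x y 1 1 0 0) = 0" "root_eval v (mix x y 1 0 1 0) = 0"
  | (sum) "root_eval v (mix x y 1 0 0 0) = 0" "root_eval v (mix x y 1 1 1 0) = 0"
  | (left) "root_eval v (mix x y 1 0 0 0) = 0" "root_eval v (mix x y 1 1 0 0) = 0"
      "root_eval v (mix x y 1 1 1 (- 1)) = 0"
  | (right) "root_eval v (mix x y 1 0 0 0) = 0" "root_eval v (mix x y 1 0 1 0) = 0"
      "root_eval v (mix x y 1 1 1 1) = 0"
proof -
  obtain i j c where c: "c = - 1 \<or> c = 0 \<or> c = 1" and e: "\<And>x. root_eval v x = x i + c * x j"
    using root_eval_form[OF assms(3)] by blast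
  have p: "x i + c * x j > 0" "y i + c * y j < 0" using assms(4,5) e by simp_all
  have t: "x i \<in> {- 1, 0, 1}" "x j \<in> {- 1, 0, 1}" "y i \<in> {- 1, 0, 1}" "y j \<in> {- 1, 0, 1}"
    using ternaryD[OF assms(1)] ternaryD[OF assms(2)] by blast+
  have c': "c \<in> {- 1, 0, 1}" using c by blast
  have r: "root_eval v (mix x y p q r s) = mix1 (x i) (y i) p q r s + c * mix1 (x j) (y j) p q r s"
    for p q r s
    unfolding e mix_def by (rule refl)
  note m = mix1_roots[rule_format, OF c' t p, folded r]
  show thesis
    using m by (elim disjE conjE) (fact that)+
qed

section \<open>Elimination between two sign vectors at a separating root\<close>

context sign_order
begin

lemma m_mix_add:
  assumes "ternary x" "ternary y"
    and "m (mix x y p q r s) \<ge> 0" "m (mix x y p' q' r' s') \<ge> 0"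
    and "{p, q, r, s, p', q', r', s', p + p', q + q', r + r', s + s'} \<subseteq> {- 1, 0, 1}"
  shows "m (mix x y (p + p') (q + q') (r + r') (s + s')) \<ge> 0"
proof -
  have "ternary (mix x y p q r s)" "ternary (mix x y p' q' r' s')"
    "ternary (mix x y (p + p') (q + q') (r + r') (s + s'))"
    using assms(5) unfolding insert_subset
    by - (elim conjE, (intro ternary_mix assms(1,2); assumption))+
  with assms(3,4) show ?thesis using m_add_eq(1) mix_add by metis
qed

lemma m_mix_uminus:
  assumes "ternary x" "ternary y" "{p, q, r, s} \<subseteq> {- 1, 0, 1}"
  shows "m (mix x y (- p) (- q) (- r) (- s)) = - m (mix x y p q r s)"
proof -
  have "ternary (mix x y p q r s)"
    using assms(3) unfolding insert_subset
    by - (elim conjE, (intro ternary_mix assms(1,2); assumption))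
  then show ?thesis using m_uminus by (metis mix_uminus)
qed

text \<open>If the claim fails, every candidate on the hyperplane is zero or has a negative value.
  In each of the four cases of \<open>mix_roots\<close>, additivity along the parts
  \<open>Q\<close>, \<open>A\<close>, \<open>B\<close>, \<open>S\<close> then gives a
  contradiction.\<close>

lemma vertex_elimination:
  assumes x: "ternary x" and y: "ternary y" and mx: "m x \<ge> 0" and my: "m y \<ge> 0" and xy: "x \<noteq> - y"
    and v: "v \<in> B_config" "root_eval v x > 0" "root_eval v y < 0"
  shows "\<exists>w. ternary w \<and> w \<noteq> 0 \<and> m w \<ge> 0 \<and> root_eval v w = 0 \<and> between x y w"
proof (rule ccontr)
  assume no: "\<not> ?thesis"
  let ?w = "mix x y"
  note add = m_mix_add[OF x y] and neg = m_mix_uminus[OF x y]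
  have neq: "m (?w p q r s) < 0 \<or> ?w p q r s = 0" if "root_eval v (?w p q r s) = 0"
    "(p, q, r, s) \<in> {(1, 0, 0, 0), (1, 1, 0, 0), (1, 0, 1, 0), (1, 1, 1, 0), (1, 1, 1, - 1), (1, 1, 1, 1)}"
    for p q r s
  proof -
    have "ternary (?w p q r s)" using that(2) by (intro ternary_mix x y) auto
    then show ?thesis using no that(1) between_mix[OF x y that(2)] by force
  qed
  then have le: "m (?w p q r s) \<le> 0" if "root_eval v (?w p q r s) = 0"
    "(p, q, r, s) \<in> {(1, 0, 0, 0), (1, 1, 0, 0), (1, 0, 1, 0), (1, 1, 1, 0), (1, 1, 1, - 1), (1, 1, 1, 1)}"
    for p q r s
    using that m_zero by (metis order.order_iff_strict)
  have mx': "m (?w 1 1 0 (- 1)) \<ge> 0" and my': "m (?w 1 0 1 1) \<ge> 0"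
    using mx my by (simp_all add: mix_left mix_right x y)
  have x0: "x \<noteq> 0" using v(2) by (auto simp: root_eval_def)
  show False using x y v
  proof (cases rule: mix_roots)
    case opp
    \<comment> \<open>By \<open>x = (Q + A) - S\<close> and \<open>y = (Q + B) + S\<close>, the part
      \<open>S\<close> would need a negative and a positive value at once, unless
      \<open>Q + A\<close> or \<open>Q + B\<close> vanishes. Then \<open>x = - S\<close> or
      \<open>y = S\<close>, which contradicts the sign of \<open>x\<close> or of \<open>y\<close>,
      or \<open>x \<noteq> - y\<close>.\<close>
    have "m (?w 0 0 0 1) < 0 \<or> ?w 1 1 0 0 = 0"
      using neq[OF opp(1)] add[OF mx', of 0 0 0 1] by force
    moreover have "m (?w 0 0 0 1) > 0 \<or> ?w 1 0 1 0 = 0"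
      using neq[OF opp(2)] add[OF my', of 0 0 0 "- 1"] neg[of 0 0 0 1] by force
    moreover have "x = ?w 0 0 0 (- 1)" if "?w 1 1 0 0 = 0"
    proof -
      have "x = ?w 1 1 0 0 + ?w 0 0 0 (- 1)" by (simp add: mix_add mix_left x y)
      then show ?thesis using that by simp
    qed
    moreover have "y = ?w 0 0 0 1" if "?w 1 0 1 0 = 0"
    proof -
      have "y = ?w 1 0 1 0 + ?w 0 0 0 1" by (simp add: mix_add mix_right)
      then show ?thesis using that by simp
    qed
    ultimately show False using mx my xy neg[of 0 0 0 1] mix_uminus[of x y 0 0 0 1] by force
  next
    case sum
    \<comment> \<open>\<open>y - Q = B + S\<close>, and adding this to \<open>x\<close> gives
      \<open>Q + A + B\<close>.\<close>
    have "m (?w (-1) 0 0 0) \<ge> 0" using le[OF sum(1)] neg[of 1 0 0 0] by simp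
    then have "m (?w 0 0 1 1) \<ge> 0" using add[OF my'] by force
    then have "m (?w 1 1 1 0) \<ge> 0" using add[OF mx'] by force
    then show False using neq[OF sum(2)] mix_eq_0(1)[OF x y, of 1 1 1 0] xy by auto
  next
    case left
    \<comment> \<open>\<open>x - (Q + A) = - S\<close> and \<open>y - Q = B + S\<close> add up to
      \<open>B\<close>; then \<open>x + B\<close> is the last candidate
      \<open>Q + A + B - S\<close>. The case \<open>right\<close> is the mirror image.\<close>
    have a: "m (?w (-1) 0 0 0) \<ge> 0" using le[OF left(1)] neg[of 1 0 0 0] by simp
    have "m (?w (-1) (-1) 0 0) \<ge> 0" using le[OF left(2)] neg[of 1 1 0 0] by simp
    then have b: "m (?w 0 0 0 (-1)) \<ge> 0" using add[OF mx'] by force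
    have "m (?w 0 0 1 1) \<ge> 0" using a add[OF my'] by force
    then have "m (?w 0 0 1 0) \<ge> 0" using add[OF b] by force
    then have "m (?w 1 1 1 (-1)) \<ge> 0" using add[OF mx'] by force
    then show False using neq[OF left(3)] mix_eq_0(2)[OF x y, of 1 1 1 "- 1"] x0 by auto
  next
    case right
    have a: "m (?w (-1) 0 0 0) \<ge> 0" using le[OF right(1)] neg[of 1 0 0 0] by simp
    have "m (?w (-1) 0 (-1) 0) \<ge> 0" using le[OF right(2)] neg[of 1 0 1 0] by simp
    then have b: "m (?w 0 0 0 1) \<ge> 0" using add[OF my'] by force
    have "m (?w 0 1 0 (-1)) \<ge> 0" using a add[OF mx'] by force
    then have "m (?w 0 1 0 0) \<ge> 0" using add[OF b] by force
    then have "m (?w 1 1 1 1) \<ge> 0" using add[OF my'] by force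
    then show False using neq[OF right(3)] mix_eq_0(2)[OF x y, of 1 1 1 1] x0 by auto
  qed
qed

end

section \<open>Elimination\<close>

lemma root_eval_lincomb:
  "root_eval v (\<lambda>i. p * x i + q * y i) = p * root_eval v x + q * root_eval v y"
  by (simp add: root_eval_def sum.distrib sum_distrib_left distrib_left mult.left_commute)

lemma root_eval_zero: "root_eval v 0 = 0"
  by (simp add: root_eval_def)

lemma cut_root_eval_nonzero:
  assumes "v \<in> B_config" "root_eval v w \<noteq> 0"
  shows "\<exists>t\<ge>1. root_eval v (\<lambda>i. cut t (w i)) \<noteq> 0"
proof (cases "root_eval v w > 0")
  case True
  then show ?thesis using cut_root_eval_pos[OF assms(1)] by force
next
  case False
  then have "root_eval v (- w) > 0" using assms(2) by (simp add: root_eval_uminus)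
  then obtain t where t: "t \<ge> 1" "root_eval v (\<lambda>i. cut t ((- w) i)) > 0"
    using cut_root_eval_pos[OF assms(1)] by blast
  have "(\<lambda>i. cut t ((- w) i)) = - (\<lambda>i. cut t (w i))" by (simp add: fun_eq_iff cut_uminus)
  then have "root_eval v (\<lambda>i. cut t (w i)) < 0" using t(2) by (simp add: root_eval_uminus)
  then show ?thesis using t(1) by force
qed

lemma between_lincomb:
  assumes "p > 0" "q > 0" shows "between x y (\<lambda>i. p * x i + q * y i)"
  unfolding between_def root_eval_lincomb
proof (intro ballI conjI impI)
  fix v :: "(real, 'a) vec"
  show "0 < root_eval v x \<or> 0 < root_eval v y" if h: "0 < p * root_eval v x + q * root_eval v y"
  proof (rule ccontr)
    assume "\<not> ?thesis"
    then have "p * root_eval v x \<le> 0" "q * root_eval v y \<le> 0"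
      using assms by (simp_all add: mult_le_0_iff)
    then show False using h by linarith
  qed
  show "root_eval v x < 0 \<or> root_eval v y < 0" if h: "p * root_eval v x + q * root_eval v y < 0"
  proof (rule ccontr)
    assume "\<not> ?thesis"
    then have "p * root_eval v x \<ge> 0" "q * root_eval v y \<ge> 0"
      using assms by (simp_all add: zero_le_mult_iff)
    then show False using h by linarith
  qed
qed

section \<open>The vectors of the extension and their elimination\<close>

context sign_order
begin

definition ext_vector :: "('n \<Rightarrow> int) \<Rightarrow> int \<Rightarrow> bool" where
  "ext_vector a s \<longleftrightarrow> (ternary a \<and> a \<noteq> 0 \<and> s = m a) \<or>
     (s = 0 \<and> (\<exists>x y. ternary x \<and> ternary y \<and> conformal_le x y \<and> m x * m y < 0 \<and> a = x + y))"

definition extension :: "((real, 'n) vec option \<Rightarrow> int) set" where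
  "extension = {adjoin_sign (root_pattern a) s | a s. ext_vector a s}"

lemma ext_vector_vertex: "ternary x \<Longrightarrow> x \<noteq> 0 \<Longrightarrow> ext_vector x (m x)"
  by (simp add: ext_vector_def)

lemma ext_vector_edge:
  "\<lbrakk>ternary x; ternary y; conformal_le x y; m x * m y < 0\<rbrakk> \<Longrightarrow> ext_vector (x + y) 0"
  unfolding ext_vector_def by blast

lemma m_nonzero: "m x \<noteq> 0 \<Longrightarrow> x \<noteq> 0"
  using m_zero by auto

text \<open>An edge is replaced by its end of positive value. So value 0 occurs only for a vector
  that was itself a vertex, which excludes opposite vertices in
  \<open>covector_elimination\<close>.\<close>

lemma ext_vector_nonneg:
  assumes "ext_vector a s" "s \<ge> 0"
  obtains x where "ternary x" "x \<noteq> 0" "m x \<ge> 0" "between a a x" "m x = 0 \<Longrightarrow> x = a \<and> s = 0"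
  using assms(1) unfolding ext_vector_def
proof (elim disjE conjE exE)
  assume "ternary a" "a \<noteq> 0" "s = m a"
  then show thesis using that[of a] assms(2) between_left by metis
next
  fix x y assume h: "ternary x" "ternary y" "conformal_le x y" "m x * m y < 0" "a = x + y"
  note b = between_conformal_sum[OF h(1-3), folded h(5)]
  show thesis
  proof (cases "m x > 0")
    case True
    then show thesis using that[of x] h b m_nonzero[of x] by simp
  next
    case False
    then have "m y > 0" using h(4) by (simp add: mult_less_0_iff)
    then show thesis using that[of y] h b m_nonzero[of y] by simp
  qed
qed

text \<open>Both vectors are replaced by vertices in their hulls. If one of these lies on the
  hyperplane of \<open>v\<close>, it is the required vector; otherwise \<open>v\<close> still
  separates them and \<open>vertex_elimination\<close> applies.\<close>

lemma covector_elimination: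
  assumes "ext_vector a s" "ext_vector b t" "s \<ge> 0" "t \<ge> 0"
    and v: "v \<in> B_config" "root_eval v a > 0" "root_eval v b < 0"
    and ne: "\<not> (a = - b \<and> s = - t)"
  obtains w where "ternary w" "w \<noteq> 0" "m w \<ge> 0" "root_eval v w = 0" "between a b w"
proof -
  obtain x where x: "ternary x" "x \<noteq> 0" "m x \<ge> 0" "between a a x" "m x = 0 \<Longrightarrow> x = a \<and> s = 0"
    using ext_vector_nonneg[OF assms(1,3)] by metis
  obtain y where y: "ternary y" "y \<noteq> 0" "m y \<ge> 0" "between b b y" "m y = 0 \<Longrightarrow> y = b \<and> t = 0"
    using ext_vector_nonneg[OF assms(2,4)] by metis
  have bx: "between a b x" and bY: "between a b y" using x(4) y(4) between_self by blast+
  have vx: "root_eval v x \<ge> 0" using x(4) v(1,2) unfolding between_def by force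
  have vy: "root_eval v y \<le> 0" using y(4) v(1,3) unfolding between_def by force
  consider "root_eval v x = 0" | "root_eval v y = 0" | "root_eval v x > 0" "root_eval v y < 0"
    using vx vy by linarith
  then show thesis
  proof cases
    case 1 then show thesis using that x bx by blast
  next
    case 2 then show thesis using that y bY by blast
  next
    case 3
    \<comment> \<open>Opposite vertices with nonnegative values both have value 0, hence are
      \<open>a\<close> and \<open>b\<close> themselves, against \<open>ne\<close>.\<close>
    have xy: "x \<noteq> - y"
    proof
      assume e: "x = - y"
      then have "m x = - m y" using m_uminus[OF y(1)] by simp
      then have "m x = 0" "m y = 0" using x(3) y(3) by simp_all
      then show False using x(5) y(5) ne e by simp
    qed
    show thesis
      using vertex_elimination[OF x(1) y(1) x(3) y(3) xy v(1) 3] that between_trans[OF bx bY] by blast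
  qed
qed

text \<open>The path is \<open>Q + A - S\<close>, \<open>Q + A + B - S\<close>,
  \<open>Q + A + B\<close>, \<open>Q + A + B + S\<close>, \<open>Q + B + S\<close>, with comparable
  neighbours. Without a zero vertex or an edge with a sign change, the positive sign of
  \<open>x\<close> would spread along it to \<open>y\<close>.\<close>

lemma zero_between:
  assumes x: "ternary x" "x \<noteq> 0" and y: "ternary y" "y \<noteq> 0" and xy: "x \<noteq> - y"
    and m: "m x \<ge> 0" "m y \<le> 0"
  shows "\<exists>a. ext_vector a 0 \<and> between x y a"
proof (rule ccontr)
  assume no: "\<not> ?thesis"
  let ?w = "mix x y"
  have nz: "m u \<noteq> 0" if "ternary u" "u \<noteq> 0" "between x y u" for u
    using no ext_vector_vertex[OF that(1,2)] that(3) by force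
  have step: "m w > 0" if "m u > 0" "ternary u" "ternary w" "conformal_le u w \<or> conformal_le w u"
    "between x y u" "between x y w" "w \<noteq> 0" for u w
  proof (rule ccontr)
    assume "\<not> ?thesis"
    then have "m u * m w < 0" "m w * m u < 0"
      using that(1) nz[OF that(3,7,6)] by (simp_all add: mult_less_0_iff)
    then have "ext_vector (u + w) 0 \<or> ext_vector (w + u) 0"
      using that(2-4) ext_vector_edge by blast
    then show False using no between_add that(5,6) by blast
  qed
  have t: "ternary (?w 1 1 1 (- 1))" "ternary (?w 1 1 1 0)" "ternary (?w 1 1 1 1)"
    by (simp_all add: ternary_mix x(1) y(1))
  have b: "between x y (?w 1 1 1 (- 1))" "between x y (?w 1 1 1 0)" "between x y (?w 1 1 1 1)"
    by (simp_all add: between_mix x(1) y(1))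
  have n: "?w 1 1 1 (- 1) \<noteq> 0" "?w 1 1 1 0 \<noteq> 0" "?w 1 1 1 1 \<noteq> 0"
    using mix_eq_0(1)[OF x(1) y(1)] xy by force+
  have ex: "?w 1 1 0 (- 1) = x" and ey: "?w 1 0 1 1 = y" using mix_left mix_right x(1) y(1) by auto
  have "m x > 0" using m(1) nz[OF x between_left] by simp
  then have "m (?w 1 1 1 (- 1)) > 0"
    using step[OF _ x(1) t(1) disjI1 between_left b(1) n(1)]
      conformal_le_mix[of 1 1 1 1 0 1 "- 1" "- 1" x y] ex by simp
  then have "m (?w 1 1 1 0) > 0"
    using step[OF _ t(1,2) disjI2 b(1,2) n(2)] conformal_le_mix[of 1 1 1 1 1 1 0 "- 1" x y] by simp
  then have "m (?w 1 1 1 1) > 0"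
    using step[OF _ t(2,3) disjI1 b(2,3) n(3)] conformal_le_mix[of 1 1 1 1 1 1 0 1 x y] by simp
  then have "m y > 0"
    using step[OF _ t(3) y(1) disjI2 b(3) between_right y(2)]
      conformal_le_mix[of 1 1 0 1 1 1 1 1 x y] ey by simp
  then show False using m(2) by simp
qed

lemma ext_vector_uminus_order:
  "sign_order.ext_vector (\<lambda>x. - m x) a s \<longleftrightarrow> ext_vector a (- s)"
  unfolding sign_order.ext_vector_def[OF sign_order_uminus] ext_vector_def by auto

lemma ext_vector_cases:
  assumes "ext_vector a s"
  obtains (vertex) "ternary a" "a \<noteq> 0" "s = m a"
  | (edge) x y where "s = 0" "ternary x" "ternary y" "conformal_le x y" "m x * m y < 0" "a = x + y"
  using assms unfolding ext_vector_def by blast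

lemma ext_vector_uminus:
  assumes "ext_vector a s" shows "ext_vector (- a) (- s)"
  using assms
proof (cases rule: ext_vector_cases)
  case vertex
  have "- a \<noteq> 0" using vertex(2) by simp
  from ext_vector_vertex[OF ternary_uminus[OF vertex(1)] this] show ?thesis
    unfolding m_uminus[OF vertex(1)] vertex(3) .
next
  case (edge x y)
  have "m (- x) * m (- y) < 0" using edge(5) by (simp add: m_uminus edge(2,3))
  moreover have "conformal_le (- x) (- y)" using edge(4) by (simp add: conformal_le_def)
  ultimately have "ext_vector (- x + - y) 0"
    by (intro ext_vector_edge ternary_uminus edge(2,3))
  moreover have "- x + - y = - a" unfolding edge(6) by (rule minus_add_distrib[symmetric])
  ultimately show ?thesis by (simp only: edge(1) minus_zero)
qed

lemma covector_elimination_nonpos: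
  assumes "ext_vector a s" "ext_vector b t" "s \<le> 0" "t \<le> 0"
    and v: "v \<in> B_config" "root_eval v a > 0" "root_eval v b < 0"
    and ne: "\<not> (a = - b \<and> s = - t)"
  obtains w where "ternary w" "w \<noteq> 0" "m w \<le> 0" "root_eval v w = 0" "between a b w"
proof -
  have e: "sign_order.ext_vector (\<lambda>x. - m x) a (- s)" "sign_order.ext_vector (\<lambda>x. - m x) b (- t)"
    using assms(1,2) by (simp_all add: ext_vector_uminus_order)
  have s: "- s \<ge> 0" "- t \<ge> 0" "\<not> (a = - b \<and> - s = - (- t))" using assms(3,4) ne by auto
  obtain w where "ternary w" "w \<noteq> 0" "- m w \<ge> 0" "root_eval v w = 0" "between a b w"
    by (rule sign_order.covector_elimination[OF sign_order_uminus e s(1,2) v s(3)])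
  then show thesis using that by simp
qed

text \<open>Elimination for \<open>m\<close> and for \<open>- m\<close> gives vertices
  \<open>w\<close>, \<open>w'\<close> on the hyperplane of \<open>v\<close> with values of either
  weak sign, and \<open>zero_between\<close> finds a zero between them. If \<open>w = - w'\<close>,
  a further vertex \<open>z\<close> on the hyperplane replaces one of the two.\<close>

lemma zero_elimination:
  assumes a: "ext_vector a 0" and b: "ext_vector b 0"
    and v: "v \<in> B_config" "root_eval v a > 0" "root_eval v b < 0"
    and ne: "root_pattern a \<noteq> - root_pattern b"
  obtains c where "ext_vector c 0" "root_eval v c = 0" "between a b c"
proof -
  have ne': "\<not> (a = - b \<and> (0::int) = - 0)" using ne root_pattern_uminus by metis
  obtain w where w: "ternary w" "w \<noteq> 0" "m w \<ge> 0" "root_eval v w = 0" "between a b w"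
    by (rule covector_elimination[OF a b order_refl order_refl v ne'])
  obtain w' where w': "ternary w'" "w' \<noteq> 0" "m w' \<le> 0" "root_eval v w' = 0" "between a b w'"
    by (rule covector_elimination_nonpos[OF a b order_refl order_refl v ne'])
  note goal = that
  have fin: thesis if "ternary x" "x \<noteq> 0" "ternary y" "y \<noteq> 0" "x \<noteq> - y" "m x \<ge> 0" "m y \<le> 0"
    "root_eval v x = 0" "root_eval v y = 0" "between a b x" "between a b y" for x y
    using zero_between[OF that(1-7)] that(8-11) goal between_trans between_zero[OF _ v(1)] by metis
  show thesis
  proof (cases "w = - w'")
    case False
    then show thesis using fin w w' by blast
  next
    case True
    \<comment> \<open>At \<open>u\<close> the signs of \<open>a\<close> and \<open>b\<close> are not
      opposite. As \<open>w\<close> and \<open>- w\<close> both lie between \<open>a\<close> and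
      \<open>b\<close>, the root \<open>u\<close> must vanish at \<open>w\<close>.\<close>
    obtain u where "root_pattern a u \<noteq> - root_pattern b u" using ne by (auto simp: fun_eq_iff)
    then have u: "u \<in> B_config" "sgn (root_eval u a) \<noteq> - sgn (root_eval u b)"
      by (auto simp: root_pattern_def split: if_splits)
    have uw: "root_eval u w = 0"
    proof (rule ccontr)
      assume "root_eval u w \<noteq> 0"
      moreover have "root_eval u w = - root_eval u w'" using True by (simp add: root_eval_uminus)
      ultimately show False
        using w(5) w'(5) u unfolding between_def by (smt (verit) sgn_if)
    qed
    \<comment> \<open>The positive combination of \<open>a\<close> and \<open>b\<close> on the
      hyperplane of \<open>v\<close>. If it vanished at \<open>u\<close>, the signs of
      \<open>a\<close> and \<open>b\<close> at \<open>u\<close> would be opposite, as they are at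
      \<open>v\<close>.\<close>
    define c where "c = (\<lambda>i. (- root_eval v b) * a i + root_eval v a * b i)"
    have vc: "root_eval v c = 0" and uc: "root_eval u c \<noteq> 0"
    proof -
      show "root_eval v c = 0" unfolding c_def root_eval_lincomb by simp
      show "root_eval u c \<noteq> 0"
      proof
        assume "root_eval u c = 0"
        then have "root_eval v b * root_eval u a = root_eval v a * root_eval u b"
          unfolding c_def root_eval_lincomb by simp
        then have "sgn (root_eval v b) * sgn (root_eval u a) = sgn (root_eval v a) * sgn (root_eval u b)"
          by (metis sgn_mult)
        then show False using u(2) v(2,3) by simp
      qed
    qed
    have bc: "between a b c" unfolding c_def using v(2,3) by (intro between_lincomb) auto
    \<comment> \<open>Rounding makes a vertex out of \<open>c\<close>; a threshold that preserves
      the nonzero value at \<open>u\<close> keeps it apart from \<open>w\<close> and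
      \<open>- w\<close>.\<close>
    obtain t where t: "t \<ge> 1" "root_eval u (\<lambda>i. cut t (c i)) \<noteq> 0"
      using cut_root_eval_nonzero[OF u(1) uc] by blast
    define z where "z = (\<lambda>i. cut t (c i))"
    have z: "ternary z" "root_eval u z \<noteq> 0" "between c c z"
      unfolding z_def using ternary_cut t between_cut by auto
    have z': "z \<noteq> 0" "z \<noteq> w" "z \<noteq> - w" "between a b z" "root_eval v z = 0"
      using z uw root_eval_zero root_eval_uminus[of u w] between_trans[OF bc bc z(3)]
        between_zero[OF z(3) v(1)] vc by auto
    show thesis
    proof (cases "m z \<ge> 0")
      case True': True
      then show thesis using fin[of z w'] z z' w' True by (metis add.inverse_inverse)
    next
      case False
      then show thesis using fin[of w z] z z' w by (metis add.inverse_inverse linear)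
    qed
  qed
qed

end

section \<open>Supports\<close>

lemma adjoin_sign_simps [simp]: "adjoin_sign C s None = s" "adjoin_sign C s (Some e) = C e"
  by (simp_all add: adjoin_sign_def)

lemma adjoin_sign_uminus: "- adjoin_sign C s = adjoin_sign (- C) (- s)"
  by (simp add: fun_eq_iff adjoin_sign_def split: option.split)

lemma adjoin_sign_inject: "adjoin_sign C s = adjoin_sign D t \<longleftrightarrow> C = D \<and> s = t"
  by (metis adjoin_sign_simps ext)

lemma root_pattern_pos: "root_pattern a v = 1 \<longleftrightarrow> v \<in> B_config \<and> root_eval v a > 0"
  by (auto simp: root_pattern_def sgn_if)

lemma root_pattern_neg: "root_pattern a v = - 1 \<longleftrightarrow> v \<in> B_config \<and> root_eval v a < 0"
  by (auto simp: root_pattern_def sgn_if)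

lemma root_pattern_zero: "root_pattern a v = 0 \<longleftrightarrow> (v \<in> B_config \<longrightarrow> root_eval v a = 0)"
  by (auto simp: root_pattern_def sgn_if)

lemma root_pattern_nonzero:
  assumes "a \<noteq> 0" shows "\<exists>v\<in>B_config. root_eval v a \<noteq> 0"
proof -
  obtain i where "a i \<noteq> 0" using assms by (auto simp: fun_eq_iff)
  then show ?thesis using root_eval_axis[of i a] B_config_single[of i] by metis
qed

text \<open>\<open>x + y\<close> has coordinates of absolute value 2 on the support of
  \<open>x\<close>, 1 on that of \<open>y - x\<close>, and 0 elsewhere. Its root relations tie
  nonzero coordinates only within these two blocks; \<open>p\<close> and \<open>q\<close> are the
  factors of \<open>z\<close> on the blocks, read off at one index of each.\<close>

lemma plane_combination:
  assumes x: "ternary x" "x \<noteq> 0" and y: "ternary y" "x \<noteq> y" and xy: "conformal_le x y"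
    and z: "ternary z" "\<forall>v\<in>B_config. root_eval v (x + y) = 0 \<longrightarrow> root_eval v z = 0"
  obtains p q where "p \<in> {- 1, 0, 1}" "q \<in> {- 1, 0, 1}" "z = (\<lambda>i. p * x i + q * (y i - x i))"
proof -
  obtain i0 where i0: "x i0 \<noteq> 0" using x(2) by (auto simp: fun_eq_iff)
  obtain j0 where "x j0 \<noteq> y j0" using y(2) by (auto simp: fun_eq_iff)
  then have j0: "x j0 = 0" "y j0 \<noteq> 0" using xy by (auto simp: conformal_le_def)
  have yi: "y i = x i" if "x i \<noteq> 0" for i using xy that by (simp add: conformal_le_def)
  note r = root_eval_zero_imp[OF z(2)]
  have sq: "x i0 * x i0 = 1" "y j0 * y j0 = 1"
    using ternaryD[OF x(1), of i0] ternaryD[OF y(1), of j0] i0 j0 by auto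
  have "z i = (z i0 * x i0) * x i + (z j0 * y j0) * (y i - x i)" for i
  proof (cases "x i = 0")
    case False
    consider "x i = x i0" | "x i = - x i0"
      using False i0 ternaryD[OF x(1), of i] ternaryD[OF x(1), of i0] by linarith
    then have "z i = z i0 * x i0 * x i"
    proof cases
      case 1
      have "z i = z i0" by (rule r(2)) (simp add: yi i0 False 1)
      then show ?thesis unfolding 1 by (simp add: sq mult.assoc)
    next
      case 2
      have "z i = - z i0" by (rule r(3)) (simp add: yi i0 False 2)
      then show ?thesis unfolding 2 by (simp add: sq mult.assoc)
    qed
    then show ?thesis using yi[OF False] by simp
  next
    case True
    consider "y i = 0" | "y i = y j0" | "y i = - y j0"
      using j0 ternaryD[OF y(1), of i] ternaryD[OF y(1), of j0] by linarith
    then have "z i = z j0 * y j0 * y i"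
    proof cases
      case 1
      have "z i = 0" by (rule r(1)) (simp add: True 1)
      then show ?thesis unfolding 1 by simp
    next
      case 2
      have "z i = z j0" by (rule r(2)) (simp add: True j0 2)
      then show ?thesis unfolding 2 by (simp add: sq mult.assoc)
    next
      case 3
      have "z i = - z j0" by (rule r(3)) (simp add: True j0 3)
      then show ?thesis unfolding 3 by (simp add: sq mult.assoc)
    qed
    then show ?thesis using True by simp
  qed
  then have "z = (\<lambda>i. (z i0 * x i0) * x i + (z j0 * y j0) * (y i - x i))" by blast
  moreover have "z i0 * x i0 \<in> {- 1, 0, 1}" "z j0 * y j0 \<in> {- 1, 0, 1}"
    using ternary_mult ternaryD[OF z(1)] ternaryD[OF x(1)] ternaryD[OF y(1)] by blast+
  ultimately show thesis using that by blast
qed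

section \<open>The sign function on the plane of an edge, and incomparability of supports\<close>

context sign_order
begin

lemma m_opposite:
  assumes "m x * m y < 0" shows "m x \<noteq> 0" "m y = - m x" "x \<noteq> y" "x \<noteq> 0" "y \<noteq> 0"
proof -
  show "m x \<noteq> 0" "m y = - m x" using assms m_range[of x] m_range[of y] by auto
  then show "x \<noteq> y" "x \<noteq> 0" "y \<noteq> 0" using m_zero by auto
qed

text \<open>
  On the plane spanned by the edge, \<open>m\<close> has the signs of the linear functional with values \<open>2\<close> at \<open>x\<close>
  and \<open>- 3\<close> at \<open>y - x\<close>, up to the sign \<open>m x\<close>.
\<close>

lemma m_plane:
  assumes x: "ternary x" and y: "ternary y" and xy: "conformal_le x y" and m: "m x * m y < 0"
    and pq: "p \<in> {- 1, 0, 1}" "q \<in> {- 1, 0, 1}"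
  shows "m (\<lambda>i. p * x i + q * (y i - x i)) = m x * sgn (2 * p - 3 * q)"
proof -
  let ?z = "\<lambda>p q i. p * x i + q * (y i - x i)"
  have t: "ternary (?z p q)" if "p \<in> {- 1, 0, 1}" "q \<in> {- 1, 0, 1}" for p q
    unfolding ternary_def
  proof
    fix i
    have "?z p q i = p * x i \<or> ?z p q i = q * y i"
      using xy by (cases "x i = 0") (simp_all add: conformal_le_def)
    then show "?z p q i = - 1 \<or> ?z p q i = 0 \<or> ?z p q i = 1"
      using ternary_mult[OF that(1) ternaryD[OF x]] ternary_mult[OF that(2) ternaryD[OF y]] by metis
  qed
  have z10: "?z 1 0 = x" and z11: "?z 1 1 = y" by (auto simp: fun_eq_iff)
  have tr: "(1::int) \<in> {- 1, 0, 1}" "(0::int) \<in> {- 1, 0, 1}" "- (1::int) \<in> {- 1, 0, 1}" by simp_all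
  have neg: "m (?z (- p) (- q)) = - m (?z p q)" if "p \<in> {- 1, 0, 1}" "q \<in> {- 1, 0, 1}" for p q
  proof -
    have "?z (- p) (- q) = - ?z p q" by (auto simp: fun_eq_iff algebra_simps)
    then show ?thesis using m_uminus[OF t[OF that]] by simp
  qed
  have n10: "m (?z (- 1) 0) = - m x" using neg[OF tr(1,2)] z10 by simp
  have n11: "m (?z (- 1) (- 1)) = - m y" using neg[OF tr(1,1)] z11 by simp
  have s01: "?z 0 1 = ?z 1 1 + ?z (- 1) 0" by (auto simp: fun_eq_iff)
  have s1n: "?z 1 (- 1) = ?z 1 0 + ?z 0 (- 1)" by (auto simp: fun_eq_iff)
  note o = m_opposite[OF m]
  \<comment> \<open>\<open>y - x\<close> is the sum of \<open>y\<close> and \<open>- x\<close>, both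
    of value \<open>- m x\<close>. Likewise \<open>x - (y - x)\<close> below is a sum of two vectors
    of value \<open>m x\<close>.\<close>
  note a01 = m_add_eq[OF t[OF tr(1,1)] t[OF tr(3,2)] s01 t[OF tr(2,1)]]
  have m01: "m (?z 0 1) = - m x"
    using a01(2,5) m_range[of x] m_range[of "?z 0 1"] o(1,2) n10 z11 by force
  have n01: "m (?z 0 (- 1)) = m x" using neg[OF tr(2,1)] m01 by simp
  note a1n = m_add_eq[OF t[OF tr(1,2)] t[OF tr(2,3)] s1n t[OF tr(1,3)]]
  have m1n: "m (?z 1 (- 1)) = m x"
    using a1n(2,5) m_range[of x] m_range[of "?z 1 (- 1)"] o(1,2) n01 z10 by force
  have nn1: "m (?z (- 1) 1) = - m x" using neg[OF tr(1,3)] m1n by simp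
  have m00: "m (?z 0 0) = 0" using m_zero by (simp add: zero_fun_def)
  have "p = - 1 \<or> p = 0 \<or> p = 1" "q = - 1 \<or> q = 0 \<or> q = 1" using pq by auto
  then show ?thesis
    using z10 z11 n10 n11 m01 n01 m1n nn1 m00 o(2) by (elim disjE) simp_all
qed

text \<open>In the coordinates \<open>p\<close>, \<open>q\<close> of the plane of an edge, the only
  edges with a sign change are the given one, from \<open>(1, 0)\<close> to \<open>(1, 1)\<close>,
  and its opposite.\<close>

lemma edge_sign_change:
  fixes p q p' q' :: int
  assumes "p \<in> {- 1, 0, 1}" "q \<in> {- 1, 0, 1}" "p' \<in> {- 1, 0, 1}" "q' \<in> {- 1, 0, 1}"
    "p = 0 \<or> p' = p" "q = 0 \<or> q' = q" "sgn (2 * p - 3 * q) * sgn (2 * p' - 3 * q') < 0"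
  shows "p = 1 \<and> q = 0 \<and> p' = 1 \<and> q' = 1 \<or> p = - 1 \<and> q = 0 \<and> p' = - 1 \<and> q' = - 1"
  using assms(1-6) assms(7) by (elim insertE emptyE; simp)

text \<open>The roots vanishing at a vertex cut out a line. An edge vector on it would have both
  ends on that line, hence opposite, whereas comparable nonzero sign vectors are never
  opposite.\<close>

lemma support_below_vertex:
  assumes "ext_vector a s" "ternary b" "b \<noteq> 0"
    "\<forall>v\<in>B_config. root_eval v b = 0 \<longrightarrow> root_eval v a = 0"
  shows "a = b \<and> s = m b \<or> a = - b \<and> s = - m b"
  using assms(1)
proof (cases rule: ext_vector_cases)
  case vertex
  then show ?thesis
    using root_support_ternary[OF assms(2,3) vertex(1,2) assms(4)] m_uminus[OF assms(2)] by metis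
next
  case (edge x y)
  have z: "root_eval v x = 0 \<and> root_eval v y = 0" if "v \<in> B_config" "root_eval v b = 0" for v
  proof -
    have "root_eval v (x + y) = 0" using assms(4) that edge(6) by blast
    then show ?thesis
      using between_zero between_conformal_sum[OF edge(2-4)] that(1) by blast
  qed
  note o = m_opposite[OF edge(5)]
  have "x = b \<or> x = - b" "y = b \<or> y = - b"
    using root_support_ternary[OF assms(2,3) edge(2) o(4)]
      root_support_ternary[OF assms(2,3) edge(3) o(5)] z by blast+
  then have "x = - y" using o(3) by auto
  then have False using conformal_le_not_opposite[OF edge(4) o(4)] by blast
  then show ?thesis ..
qed

text \<open>Everything happens in the plane of the edge. With \<open>p\<close> and \<open>q\<close>
  in {-1, 0, 1}, the functional \<open>2 * p - 3 * q\<close> vanishes only at the origin, so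
  \<open>a\<close> is no vertex of value 0, and \<open>edge_sign_change\<close> settles the
  edges.\<close>

lemma support_below_edge:
  assumes "ext_vector a s" "ternary x" "ternary y" "conformal_le x y" "m x * m y < 0"
    "\<forall>v\<in>B_config. root_eval v (x + y) = 0 \<longrightarrow> root_eval v a = 0" "s = 0"
  shows "a = x + y \<or> a = - (x + y)"
proof -
  note o = m_opposite[OF assms(5)]
  let ?z = "\<lambda>p q i. p * x i + q * (y i - x i)"
  show ?thesis using assms(1)
  proof (cases rule: ext_vector_cases)
    case vertex
    obtain p q where pq: "p \<in> {- 1, 0, 1}" "q \<in> {- 1, 0, 1}" "a = ?z p q"
      using plane_combination[OF assms(2) o(4) assms(3) o(3) assms(4) vertex(1) assms(6)] by metis
    have "m x * sgn (2 * p - 3 * q) = 0"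
      using m_plane[OF assms(2-5) pq(1,2)] pq(3) vertex(3) assms(7) by simp
    then have "2 * p = 3 * q" using o(1) by (simp add: sgn_if split: if_splits)
    then have "p = 0" "q = 0" using pq(1,2) by auto
    then have "a = 0" using pq(3) by (simp add: fun_eq_iff)
    then show ?thesis using vertex(2) by simp
  next
    case (edge x' y')
    note b = between_conformal_sum[OF edge(2-4), folded edge(6)]
    have z: "\<forall>v\<in>B_config. root_eval v (x + y) = 0 \<longrightarrow> root_eval v x' = 0"
      "\<forall>v\<in>B_config. root_eval v (x + y) = 0 \<longrightarrow> root_eval v y' = 0"
      using assms(6) between_zero b by blast+
    obtain p q where pq: "p \<in> {- 1, 0, 1}" "q \<in> {- 1, 0, 1}" "x' = ?z p q"
      using plane_combination[OF assms(2) o(4) assms(3) o(3) assms(4) edge(2) z(1)] by metis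
    obtain p' q' where pq': "p' \<in> {- 1, 0, 1}" "q' \<in> {- 1, 0, 1}" "y' = ?z p' q'"
      using plane_combination[OF assms(2) o(4) assms(3) o(3) assms(4) edge(3) z(2)] by metis
    obtain i where i: "x i \<noteq> 0" using o(4) by (auto simp: fun_eq_iff)
    then have i': "y i = x i" using assms(4) by (simp add: conformal_le_def)
    obtain j where "x j \<noteq> y j" using o(3) by (auto simp: fun_eq_iff)
    then have j: "x j = 0" "y j \<noteq> 0" using assms(4) by (auto simp: conformal_le_def)
    have "x' i = p * x i" "y' i = p' * x i" "x' j = q * y j" "y' j = q' * y j"
      using i' j(1) by (simp_all add: pq(3) pq'(3))
    then have pp: "p = 0 \<or> p' = p" "q = 0 \<or> q' = q"
      using edge(4) i j(2) unfolding conformal_le_def by (metis mult_cancel_right mult_eq_0_iff)+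
    have sg: "sgn (2 * p - 3 * q) * sgn (2 * p' - 3 * q') < 0"
    proof -
      have "m x' * m y' = (m x * m x) * (sgn (2 * p - 3 * q) * sgn (2 * p' - 3 * q'))"
        using m_plane[OF assms(2-5) pq(1,2)] m_plane[OF assms(2-5) pq'(1,2)] pq(3) pq'(3)
        by (simp add: mult_ac)
      moreover have "m x * m x = 1" using o(1) m_range[of x] by auto
      ultimately show ?thesis using edge(5) by simp
    qed
    note edge_sign_change[OF pq(1,2) pq'(1,2) pp sg]
    then show ?thesis unfolding edge(6) pq(3) pq'(3) by (auto simp: fun_eq_iff)
  qed
qed

end

section \<open>Oriented matroids and one-element extensions\<close>

lemma sv_support_uminus [simp]: "sv_support (- X) = sv_support X"
  by (simp add: sv_support_def)

lemma minimal_sign_vector_below: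
  assumes "X \<in> S" "finite (sv_support X)" "sv_support X \<noteq> {}"
  obtains Y where "Y \<in> minimal_sign_vectors S" "sv_support Y \<subseteq> sv_support X"
proof -
  define P where "P Y \<longleftrightarrow> Y \<in> S \<and> sv_support Y \<noteq> {} \<and> sv_support Y \<subseteq> sv_support X" for Y
  have "P X" using assms by (simp add: P_def)
  then obtain Y where Y: "P Y" "\<And>Z. P Z \<Longrightarrow> card (sv_support Y) \<le> card (sv_support Z)"
    using ex_has_least_nat[of P X "\<lambda>Y. card (sv_support Y)"] by blast
  have "\<not> sv_support Z \<subset> sv_support Y" if Z: "Z \<in> S" "sv_support Z \<noteq> {}" for Z
  proof
    assume l: "sv_support Z \<subset> sv_support Y"
    then have "P Z" using Z Y(1) by (auto simp: P_def)
    moreover have "finite (sv_support Y)" using Y(1) assms(2) by (auto simp: P_def intro: finite_subset)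
    ultimately show False using Y(2) psubset_card_mono[OF _ l] by force
  qed
  then have "Y \<in> minimal_sign_vectors S" using Y(1) by (simp add: P_def minimal_sign_vectors_def)
  then show thesis using that Y(1) unfolding P_def by blast
qed

section \<open>Elimination for the supports of an oriented matroid\<close>

context
  fixes E :: "'e set" and D :: "('e \<Rightarrow> int) set"
  assumes om: "oriented_matroid E D"
begin

lemma om_sign_vector: "X \<in> D \<Longrightarrow> X \<in> sign_vectors E"
  using om unfolding oriented_matroid_def by blast

lemma om_sign: "X \<in> D \<Longrightarrow> X e = - 1 \<or> X e = 0 \<or> X e = 1"
  using om_sign_vector unfolding sign_vectors_def by blast

lemma om_support_subset: "X \<in> D \<Longrightarrow> sv_support X \<subseteq> E"
  using om_sign_vector unfolding sign_vectors_def sv_support_def by blast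

lemma om_finite_support: "X \<in> D \<Longrightarrow> finite (sv_support X)"
proof -
  have "finite E" using om by (simp add: oriented_matroid_def)
  then show "X \<in> D \<Longrightarrow> finite (sv_support X)" using om_support_subset finite_subset by blast
qed

lemma om_support_nonempty: "X \<in> D \<Longrightarrow> sv_support X \<noteq> {}"
  using om unfolding oriented_matroid_def by blast

lemma om_uminus: "X \<in> D \<Longrightarrow> - X \<in> D"
  using om unfolding oriented_matroid_def by blast

lemma om_incomparable: "X \<in> D \<Longrightarrow> Y \<in> D \<Longrightarrow> sv_support X \<subseteq> sv_support Y \<Longrightarrow> X = Y \<or> X = - Y"
  using om unfolding oriented_matroid_def by blast

lemma om_elimination:
  assumes "X \<in> D" "Y \<in> D" "X \<noteq> - Y" "X e = 1" "Y e = - 1"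
  obtains Z where "Z \<in> D" "pos_part Z \<subseteq> (pos_part X \<union> pos_part Y) - {e}"
    "neg_part Z \<subseteq> (neg_part X \<union> neg_part Y) - {e}"
proof -
  have "e \<in> pos_part X \<inter> neg_part Y" using assms(4,5) by (simp add: pos_part_def neg_part_def)
  then show thesis using om assms(1-3) that unfolding oriented_matroid_def by blast
qed

lemma om_support_elimination:
  assumes X: "X \<in> D" and Y: "Y \<in> D" and ne: "X \<noteq> Y" "X \<noteq> - Y" and e: "X e \<noteq> 0" "Y e \<noteq> 0"
  obtains Z where "Z \<in> D" "sv_support Z \<subseteq> sv_support X \<union> sv_support Y - {e}"
proof -
  have *: "\<exists>Z\<in>D. sv_support Z \<subseteq> sv_support X \<union> sv_support Y - {e}"
    if h: "X \<in> D" "Y \<in> D" "X \<noteq> - Y" "X e = 1" "Y e = - 1" for X Y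
  proof -
    obtain Z where Z: "Z \<in> D" "pos_part Z \<subseteq> (pos_part X \<union> pos_part Y) - {e}"
      "neg_part Z \<subseteq> (neg_part X \<union> neg_part Y) - {e}"
      by (rule om_elimination[OF h])
    have "sv_support W = pos_part W \<union> neg_part W" if "W \<in> D" for W
      using om_sign[OF that] by (auto simp: sv_support_def pos_part_def neg_part_def)
    then show ?thesis using Z h(1,2) by (intro bexI[of _ Z]) auto
  qed
  have m: "- X \<noteq> - Y" "X \<noteq> - (- Y)" "- X \<noteq> - (- Y)"
    using ne by (metis minus_minus)+
  consider "X e = 1" "Y e = - 1" | "X e = 1" "Y e = 1" | "X e = - 1" "Y e = 1" | "X e = - 1" "Y e = - 1"
    using e om_sign[OF X, of e] om_sign[OF Y, of e] by blast
  then show thesis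
  proof cases
    case 1 then show thesis using *[OF X Y ne(2)] that by blast
  next
    case 2 then show thesis using *[OF X om_uminus[OF Y] m(2)] that by force
  next
    case 3 then show thesis using *[OF om_uminus[OF X] om_uminus[OF Y] m(3)] that by force
  next
    case 4 then show thesis using *[OF om_uminus[OF X] Y m(1)] that by force
  qed
qed

text \<open>The usual induction on the size of the union: when weak elimination loses
  \<open>f\<close>, two eliminations inside smaller unions recover it.\<close>

lemma om_strong_elimination:
  assumes "X \<in> D" "Y \<in> D" "X e \<noteq> 0" "Y e \<noteq> 0" "X f \<noteq> 0" "Y f = 0"
  shows "\<exists>Z\<in>D. Z f \<noteq> 0 \<and> sv_support Z \<subseteq> sv_support X \<union> sv_support Y - {e}"
  using assms
proof (induction "card (sv_support X \<union> sv_support Y)" arbitrary: X Y e f rule: less_induct)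
  case less
  note X = less.prems(1) and Y = less.prems(2)
  have fin: "finite (sv_support X \<union> sv_support Y)" using om_finite_support X Y by blast
  have ne: "X \<noteq> Y" "X \<noteq> - Y" using less.prems(5,6) by auto
  obtain Z where Z: "Z \<in> D" "sv_support Z \<subseteq> sv_support X \<union> sv_support Y - {e}"
    using om_support_elimination[OF X Y ne less.prems(3,4)] by metis
  show ?case
  proof (cases "Z f = 0")
    case False
    then show ?thesis using Z by blast
  next
    case Zf: True
    have "\<not> sv_support Z \<subseteq> sv_support X"
    proof
      assume "sv_support Z \<subseteq> sv_support X"
      then have "Z = X \<or> Z = - X" using om_incomparable Z(1) X by blast
      then show False using Zf less.prems(5) by auto
    qed
    \<comment> \<open>The union of \<open>Y\<close> and \<open>Z\<close> omits \<open>f\<close>;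
      eliminating \<open>g\<close> there while keeping \<open>e\<close> gives \<open>W\<close>,
      which vanishes at \<open>f\<close> and \<open>g\<close>. The union of \<open>X\<close> and
      \<open>W\<close> then omits \<open>g\<close>, and eliminating \<open>e\<close> there keeps
      \<open>f\<close>.\<close>
    then obtain g where g: "Z g \<noteq> 0" "X g = 0" by (auto simp: sv_support_def)
    then have Yg: "Y g \<noteq> 0" using Z(2) by (auto simp: sv_support_def)
    have Ze: "Z e = 0" using Z(2) by (auto simp: sv_support_def)
    have "sv_support Y \<union> sv_support Z \<subset> sv_support X \<union> sv_support Y"
      using Z(2) Zf less.prems(5,6) by (auto simp: sv_support_def)
    then obtain W where W: "W \<in> D" "W e \<noteq> 0" "sv_support W \<subseteq> sv_support Y \<union> sv_support Z - {g}"
      using less.hyps[OF psubset_card_mono[OF fin], OF _ Y Z(1) Yg g(1) less.prems(4) Ze] by blast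
    have Wf: "W f = 0" using W(3) Zf less.prems(6) by (auto simp: sv_support_def)
    have "sv_support X \<union> sv_support W \<subset> sv_support X \<union> sv_support Y"
      using W(3) Z(2) g(2) Yg by (auto simp: sv_support_def)
    then obtain V where V: "V \<in> D" "V f \<noteq> 0" "sv_support V \<subseteq> sv_support X \<union> sv_support W - {e}"
      using less.hyps[OF psubset_card_mono[OF fin], OF _ X W(1) less.prems(3) W(2) less.prems(5) Wf]
      by blast
    then show ?thesis using W(3) Z(2) by blast
  qed
qed

lemma om_spanning_ground: "om_spanning E D E"
  unfolding om_spanning_def using om_support_subset om_support_nonempty by blast

end

section \<open>Rank and deletion of the new element\<close>

lemma om_rank_attained:
  assumes "om_spanning E D A"
  shows "\<exists>A. om_spanning E D A \<and> card A = om_rank E D"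
  unfolding om_rank_def by (rule LeastI_ex) (use assms in blast)

lemma om_rank_le: "om_spanning E D A \<Longrightarrow> om_rank E D \<le> card A"
  unfolding om_rank_def by (rule Least_le) blast

lemma sv_support_comp_Some: "e \<in> sv_support (Z \<circ> Some) \<longleftrightarrow> Some e \<in> sv_support Z"
  by (simp add: sv_support_def)

lemma restrict_to_oldE:
  assumes "C \<in> restrict_to_old D'"
  obtains Y where "Y \<in> D'" "C = Y \<circ> Some"
  using assms unfolding restrict_to_old_def minimal_sign_vectors_def by blast

context
  fixes E :: "'e set" and D' :: "('e option \<Rightarrow> int) set"
  assumes om: "oriented_matroid (ext_ground E) D'"
begin

lemma finite_support_restriction: "Z \<in> D' \<Longrightarrow> finite (sv_support (Z \<circ> Some))"
proof -
  assume "Z \<in> D'"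
  then have "Some ` sv_support (Z \<circ> Some) \<subseteq> sv_support Z" "finite (sv_support Z)"
    using om_finite_support[OF om] by (auto simp: sv_support_def)
  then show ?thesis using finite_subset finite_image_iff inj_Some by (metis finite_imageD inj_on_subset subset_UNIV)
qed

text \<open>A restriction of least support among those nonzero at \<open>e\<close> is minimal among
  all nonzero ones: one properly below it would vanish at \<open>e\<close>, and strong elimination
  against it would give a smaller one still nonzero at \<open>e\<close>.\<close>

lemma restriction_covered:
  assumes "Z \<in> D'" "Z (Some e) \<noteq> 0"
  obtains C where "C \<in> restrict_to_old D'" "C e \<noteq> 0" "sv_support C \<subseteq> sv_support (Z \<circ> Some)"
proof -
  define P where "P Y \<longleftrightarrow> Y \<in> D' \<and> Y (Some e) \<noteq> 0 \<and> sv_support (Y \<circ> Some) \<subseteq> sv_support (Z \<circ> Some)" for Y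
  have "P Z" using assms by (simp add: P_def)
  then obtain Y where Y: "P Y" "\<And>T. P T \<Longrightarrow> card (sv_support (Y \<circ> Some)) \<le> card (sv_support (T \<circ> Some))"
    using ex_has_least_nat[of P Z "\<lambda>Y. card (sv_support (Y \<circ> Some))"] by blast
  note Y' = Y(1)[unfolded P_def]
  have smaller: False if T: "T \<in> D'" "T (Some e) \<noteq> 0" "sv_support (T \<circ> Some) \<subset> sv_support (Y \<circ> Some)" for T
  proof -
    have "P T" using T Y' by (auto simp: P_def)
    then show False
      using Y(2) psubset_card_mono[OF finite_support_restriction T(3)] Y' by force
  qed
  have "\<not> sv_support (T \<circ> Some) \<subset> sv_support (Y \<circ> Some)" if T: "T \<in> D'" "sv_support (T \<circ> Some) \<noteq> {}" for T
  proof
    assume l: "sv_support (T \<circ> Some) \<subset> sv_support (Y \<circ> Some)"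
    then have Te: "T (Some e) = 0" using smaller T(1) by blast
    obtain g where g: "T (Some g) \<noteq> 0" using T(2) by (auto simp: sv_support_def)
    then have Yg: "Y (Some g) \<noteq> 0" using l by (auto simp: sv_support_def)
    obtain V where V: "V \<in> D'" "V (Some e) \<noteq> 0"
      "sv_support V \<subseteq> sv_support Y \<union> sv_support T - {Some g}"
      using om_strong_elimination[OF om, of Y T "Some g" "Some e"] Y' T(1) Yg g Te by blast
    have "sv_support (V \<circ> Some) \<subseteq> sv_support (Y \<circ> Some) - {g}"
      using V(3) l by (auto simp: sv_support_def)
    then have "sv_support (V \<circ> Some) \<subset> sv_support (Y \<circ> Some)"
      using Yg by (auto simp: sv_support_def)
    then show False using smaller V(1,2) by blast
  qed
  then have "Y \<circ> Some \<in> restrict_to_old D'"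
    unfolding restrict_to_old_def minimal_sign_vectors_def
    using Y' by (auto simp: sv_support_def)
  then show thesis using that Y' by auto
qed

text \<open>The new element is dropped from \<open>A'\<close>. If the rest does not span the
  deletion, one old element takes its place.\<close>

lemma spanning_restriction:
  assumes sp: "om_spanning (ext_ground E) D' A'"
  shows "\<exists>A. om_spanning E (restrict_to_old D') A \<and> card A \<le> card A'"
proof -
  define A where "A = {e. Some e \<in> A'}"
  have A: "A \<subseteq> E" using sp by (auto simp: A_def om_spanning_def ext_ground_def)
  have fin': "finite A'"
    using sp om finite_subset by (auto simp: om_spanning_def oriented_matroid_def)
  have fin: "finite A" unfolding A_def using fin' by (rule finite_vimageI[of A' Some, unfolded vimage_def]) simp
  have im: "A' - {None} = Some ` A" by (auto simp: A_def image_iff) (metis not_None_eq)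
  then have card: "card A = card (A' - {None})" by (simp add: card_image)
  show ?thesis
  proof (cases "om_spanning E (restrict_to_old D') A")
    case True
    then show ?thesis using card fin' card_mono[of A' "A' - {None}"] by auto
  next
    case False
    then obtain C where C: "C \<in> restrict_to_old D'" "A \<inter> sv_support C = {}"
      using A by (auto simp: om_spanning_def)
    obtain Y where Y: "Y \<in> D'" "C = Y \<circ> Some" using C(1) by (rule restrict_to_oldE)
    have meets: "None \<in> A' \<and> T None \<noteq> 0" if h: "T \<in> D'" "A \<inter> sv_support (T \<circ> Some) = {}" for T
    proof -
      have "A' \<inter> sv_support T \<noteq> {}" using sp h(1) by (simp add: om_spanning_def)
      then obtain x where "x \<in> A'" "T x \<noteq> 0" by (auto simp: sv_support_def)
      then show ?thesis using h(2) by (cases x) (auto simp: A_def sv_support_def)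
    qed
    have Cne: "sv_support C \<noteq> {}"
      using C(1) by (auto simp: restrict_to_old_def minimal_sign_vectors_def)
    then obtain e where e: "C e \<noteq> 0" by (auto simp: sv_support_def)
    have eE: "e \<in> E"
      using om_support_subset[OF om Y(1)] e Y(2) by (auto simp: sv_support_def ext_ground_def)
    \<comment> \<open>\<open>e\<close> lies in the support of a missed cocircuit \<open>C\<close>.
      If another cocircuit were still missed, elimination of the new element would give a cocircuit
      avoiding all of \<open>A'\<close>.\<close>
    have "om_spanning E (restrict_to_old D') (insert e A)"
      unfolding om_spanning_def
    proof (intro conjI ballI notI)
      show "insert e A \<subseteq> E" using A eE by blast
      fix C2 assume C2: "C2 \<in> restrict_to_old D'" "insert e A \<inter> sv_support C2 = {}"
      obtain T where T: "T \<in> D'" "C2 = T \<circ> Some" using C2(1) by (rule restrict_to_oldE)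
      have Te: "T (Some e) = 0" using C2(2) T(2) by (auto simp: sv_support_def)
      then have ne: "Y \<noteq> T" "Y \<noteq> - T" using e Y(2) by auto
      have n: "None \<in> A'" "Y None \<noteq> 0" "T None \<noteq> 0" using meets Y T C(2) C2(2) by auto
      obtain V where V: "V \<in> D'" "sv_support V \<subseteq> sv_support Y \<union> sv_support T - {None}"
        using om_support_elimination[OF om Y(1) T(1) ne n(2,3)] by metis
      have "A \<inter> sv_support (V \<circ> Some) = {}"
        using V(2) C(2) C2(2) Y(2) T(2) by (auto simp: sv_support_def)
      then have "V None \<noteq> 0" using meets V(1) by blast
      then show False using V(2) by (auto simp: sv_support_def)
    qed
    moreover have "card (insert e A) \<le> card A'"
    proof -
      have "None \<in> A'" using meets[OF Y(1)] C(2) Y(2) by simp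
      then have "card A < card A'" unfolding card using fin' by (intro card_Diff1_less)
      then show ?thesis using card_insert_le_m1[of "card A'" A e] by simp
    qed
    ultimately show ?thesis by blast
  qed
qed

text \<open>The hypothesis says that the new element is not a coloop. Then the support of every
  cocircuit contains that of one of the deletion, so spanning sets of the deletion stay
  spanning.\<close>

lemma no_coloop_imp_same_rank:
  assumes "\<And>Z. Z \<in> D' \<Longrightarrow> sv_support (Z \<circ> Some) \<noteq> {}"
  shows "om_rank (ext_ground E) D' = om_rank E (restrict_to_old D')"
proof (rule antisym)
  obtain A' where A': "om_spanning (ext_ground E) D' A'" "card A' = om_rank (ext_ground E) D'"
    using om_rank_attained[OF om_spanning_ground[OF om]] by blast
  then show "om_rank E (restrict_to_old D') \<le> om_rank (ext_ground E) D'"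
    using spanning_restriction om_rank_le order_trans by metis
  obtain A where A: "om_spanning E (restrict_to_old D') A" "card A = om_rank E (restrict_to_old D')"
    using spanning_restriction[OF A'(1)] om_rank_attained by metis
  have "om_spanning (ext_ground E) D' (Some ` A)"
    unfolding om_spanning_def
  proof (intro conjI ballI)
    show "Some ` A \<subseteq> ext_ground E" using A(1) by (auto simp: om_spanning_def ext_ground_def)
    fix Z assume Z: "Z \<in> D'"
    obtain C where C: "C \<in> restrict_to_old D'" "sv_support C \<subseteq> sv_support (Z \<circ> Some)"
      using minimal_sign_vector_below[OF imageI[OF Z, of "\<lambda>Y. Y \<circ> Some"]
          finite_support_restriction[OF Z] assms(1)[OF Z]]
      unfolding restrict_to_old_def by metis
    have "A \<inter> sv_support C \<noteq> {}" using A(1) C(1) by (simp add: om_spanning_def)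
    then obtain e where "e \<in> A" "e \<in> sv_support (Z \<circ> Some)" using C(2) by blast
    then have "Some e \<in> Some ` A \<inter> sv_support Z" by (simp add: sv_support_comp_Some)
    then show "Some ` A \<inter> sv_support Z \<noteq> {}" by blast
  qed
  then show "om_rank (ext_ground E) D' \<le> om_rank E (restrict_to_old D')"
    using om_rank_le A(2) by (metis card_image inj_Some)
qed

text \<open>A cocircuit supported on the new element alone puts that element into every spanning
  set. Removing it from a smallest one leaves a spanning set of the deletion, so the ranks would
  differ.\<close>

lemma same_rank_imp_no_coloop:
  assumes rk: "om_rank (ext_ground E) D' = om_rank E (restrict_to_old D')" and Z: "Z \<in> D'"
  shows "sv_support (Z \<circ> Some) \<noteq> {}"
proof
  assume z: "sv_support (Z \<circ> Some) = {}"
  obtain A' where A': "om_spanning (ext_ground E) D' A'" "card A' = om_rank (ext_ground E) D'"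
    using om_rank_attained[OF om_spanning_ground[OF om]] by blast
  define A where "A = {e. Some e \<in> A'}"
  have sub: "sv_support Z \<subseteq> {None}"
  proof
    fix x assume "x \<in> sv_support Z"
    then show "x \<in> {None}" using z by (cases x) (auto simp: sv_support_def)
  qed
  then have None: "None \<in> A'" using A'(1) Z by (auto simp: om_spanning_def)
  have fin': "finite A'"
    using A'(1) om finite_subset by (auto simp: om_spanning_def oriented_matroid_def)
  have im: "A' - {None} = Some ` A" by (auto simp: A_def image_iff) (metis not_None_eq)
  then have card: "card A = card (A' - {None})" by (simp add: card_image)
  have "om_spanning E (restrict_to_old D') A"
    unfolding om_spanning_def
  proof (intro conjI ballI)
    show "A \<subseteq> E" using A'(1) by (auto simp: A_def om_spanning_def ext_ground_def)
    fix C assume C: "C \<in> restrict_to_old D'"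
    obtain Y where Y: "Y \<in> D'" "C = Y \<circ> Some" using C by (rule restrict_to_oldE)
    have Cne: "sv_support C \<noteq> {}"
      using C by (auto simp: restrict_to_old_def minimal_sign_vectors_def)
    have "Y None = 0"
    proof (rule ccontr)
      assume "Y None \<noteq> 0"
      then have "sv_support Z \<subseteq> sv_support Y" using sub by (auto simp: sv_support_def)
      then have "Z = Y \<or> Z = - Y" using om_incomparable[OF om Z Y(1)] by blast
      then have "sv_support Z = sv_support Y" by auto
      then show False using Cne z Y(2) by (auto simp: sv_support_def)
    qed
    moreover have "A' \<inter> sv_support Y \<noteq> {}" using A'(1) Y(1) by (simp add: om_spanning_def)
    then obtain x where "x \<in> A'" "Y x \<noteq> 0" by (auto simp: sv_support_def)
    ultimately show "A \<inter> sv_support C \<noteq> {}"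
      using Y(2) by (cases x) (auto simp: A_def sv_support_def)
  qed
  then have "om_rank E (restrict_to_old D') \<le> card A" by (rule om_rank_le)
  moreover have "card A < card A'" unfolding card using None fin' by (intro card_Diff1_less)
  ultimately show False using rk A'(2) by simp
qed

end

text \<open>A cocircuit \<open>Z\<close> of \<open>D2\<close> lies over cocircuits of
  \<open>D\<close>, and these lift to \<open>D1\<close>. A lift with support inside that of
  \<open>Z\<close> is \<open>Z\<close> up to sign. Otherwise two lifts are nonzero at the new
  element while \<open>Z\<close> vanishes there, and eliminating it between them produces such a
  member of \<open>D1\<close>.\<close>

lemma one_element_extension_maximal:
  assumes D1: "D1 \<in> one_element_extensions E D" and D2: "D2 \<in> one_element_extensions E D"
    and sub: "D1 \<subseteq> D2"
  shows "D1 = D2"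
proof
  have om1: "oriented_matroid (ext_ground E) D1" and r1: "restrict_to_old D1 = D"
    using D1 by (auto simp: one_element_extensions_def)
  have om2: "oriented_matroid (ext_ground E) D2" and r2: "restrict_to_old D2 = D"
    and rk2: "om_rank (ext_ground E) D2 = om_rank E (restrict_to_old D2)"
    using D2 by (auto simp: one_element_extensions_def)
  show "D2 \<subseteq> D1"
  proof
    fix Z assume Z: "Z \<in> D2"
    have in1: "Z \<in> D1" if "Y \<in> D1" "sv_support Y \<subseteq> sv_support Z \<or> sv_support Z \<subseteq> sv_support Y" for Y
      using that om_incomparable[OF om2 _ Z] om_incomparable[OF om2 Z] sub om_uminus[OF om1]
      by (metis add.inverse_inverse subsetD)
    have below: "Z \<in> D1 \<or> (Z None = 0 \<and> Y None \<noteq> 0)"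
      if "Y \<in> D1" "sv_support (Y \<circ> Some) \<subseteq> sv_support (Z \<circ> Some)" for Y
    proof (rule disjCI)
      assume n: "\<not> (Z None = 0 \<and> Y None \<noteq> 0)"
      have "sv_support Y \<subseteq> sv_support Z"
      proof
        fix x assume "x \<in> sv_support Y"
        then show "x \<in> sv_support Z" using n that(2) by (cases x) (auto simp: sv_support_def)
      qed
      then show "Z \<in> D1" using in1 that(1) by blast
    qed
    obtain e where "Z (Some e) \<noteq> 0"
      using same_rank_imp_no_coloop[OF om2 rk2 Z] by (auto simp: sv_support_def)
    then obtain C where C: "C \<in> D" "sv_support C \<subseteq> sv_support (Z \<circ> Some)"
      using restriction_covered[OF om2 Z] r2 by metis
    obtain Y where Y: "Y \<in> D1" "C = Y \<circ> Some" using C(1) r1 restrict_to_oldE by metis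
    show "Z \<in> D1"
    proof (rule ccontr)
      assume nZ: "Z \<notin> D1"
      then have n: "Z None = 0" "Y None \<noteq> 0" using below Y C(2) by blast+
      \<comment> \<open>This yields an old element \<open>f\<close> in the support of
        \<open>Z\<close> at which \<open>Y\<close> vanishes; a cocircuit through \<open>f\<close>
        then has a lift different from \<open>Y\<close> and \<open>- Y\<close>.\<close>
      have "\<not> sv_support Z \<subseteq> sv_support Y" using in1 Y(1) nZ by blast
      then obtain x where x: "Z x \<noteq> 0" "Y x = 0" by (auto simp: sv_support_def)
      then obtain f where f: "x = Some f" using n by (cases x) auto
      obtain C2 where C2: "C2 \<in> D" "C2 f \<noteq> 0" "sv_support C2 \<subseteq> sv_support (Z \<circ> Some)"
        using restriction_covered[OF om2 Z] r2 x(1) f by metis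
      obtain T where T: "T \<in> D1" "C2 = T \<circ> Some" using C2(1) r1 restrict_to_oldE by metis
      have nT: "T None \<noteq> 0" using below T C2(3) nZ by blast
      have ne: "Y \<noteq> T" "Y \<noteq> - T" using x(2) f C2(2) T(2) by auto
      obtain V where V: "V \<in> D1" "sv_support V \<subseteq> sv_support Y \<union> sv_support T - {None}"
        using om_support_elimination[OF om1 Y(1) T(1) ne n(2) nT] by metis
      have "sv_support V \<subseteq> sv_support Z"
      proof
        fix x assume "x \<in> sv_support V"
        then show "x \<in> sv_support Z"
          using V(2) C(2) C2(3) Y(2) T(2) by (cases x) (auto simp: sv_support_def)
      qed
      then show False using in1 V(1) nZ by blast
    qed
  qed
qed (rule sub)

section \<open>The extension of a sign function\<close>

lemma inner_of_int_vec:
  assumes "v \<in> B_config"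
  shows "(\<chi> i. real_of_int (x i)) \<bullet> v = real_of_int (root_eval v x)"
  using assms by (rule root_eval_inner_form) simp

text \<open>Taking signs is odd and monotone, so rounding can annihilate the value of a root but
  never reverse it.\<close>

lemma root_eval_sign_of:
  assumes "v \<in> B_config"
  shows "y \<bullet> v > 0 \<Longrightarrow> root_eval v (\<lambda>i. sign_of (y $ i)) \<ge> 0"
    and "y \<bullet> v < 0 \<Longrightarrow> root_eval v (\<lambda>i. sign_of (y $ i)) \<le> 0"
    and "y \<bullet> v = 0 \<Longrightarrow> root_eval v (\<lambda>i. sign_of (y $ i)) = 0"
proof -
  obtain i j c where c: "c = - 1 \<or> c = 0 \<or> c = 1" and e: "\<And>x. root_eval v x = x i + c * x j"
    and i: "\<And>y. y \<bullet> v = y $ i + real_of_int c * y $ j"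
    using assms by (rule root_eval_inner_form) blast
  show "y \<bullet> v > 0 \<Longrightarrow> root_eval v (\<lambda>i. sign_of (y $ i)) \<ge> 0"
    "y \<bullet> v < 0 \<Longrightarrow> root_eval v (\<lambda>i. sign_of (y $ i)) \<le> 0"
    "y \<bullet> v = 0 \<Longrightarrow> root_eval v (\<lambda>i. sign_of (y $ i)) = 0"
    unfolding e i using c by (auto simp: sign_of_def)
qed

lemma ternary_sign_of: "ternary (\<lambda>i. sign_of (y i))"
  by (simp add: ternary_def sign_of_def)

lemma root_pattern_config_covector:
  "root_pattern x = config_covector B_config (\<chi> i. real_of_int (x i))"
  by (auto simp: fun_eq_iff root_pattern_def config_covector_def inner_of_int_vec sign_of_def sgn_if)

lemma sv_support_root_pattern: "sv_support (root_pattern x) = {v \<in> B_config. root_eval v x \<noteq> 0}"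
  by (auto simp: sv_support_def root_pattern_zero)

lemma root_pattern_support_le:
  assumes "ternary b" "b \<noteq> 0" "ternary a" "a \<noteq> 0"
    "sv_support (root_pattern a) \<subseteq> sv_support (root_pattern b)"
  shows "a = b \<or> a = - b"
  using assms(5) unfolding sv_support_root_pattern by (intro root_support_ternary assms(1-4)) blast

lemma sv_support_root_pattern_uminus: "sv_support (root_pattern (- x)) = sv_support (root_pattern x)"
  by (simp add: root_pattern_uminus)

lemma covector_above_ternary:
  assumes "sv_support (config_covector B_config y) \<noteq> {}"
  obtains u where "ternary u" "u \<noteq> 0"
    "sv_support (root_pattern u) \<subseteq> sv_support (config_covector B_config y)"
    "sv_support (root_pattern u) = sv_support (config_covector B_config y) \<Longrightarrow>
      config_covector B_config y = root_pattern u"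
proof -
  define u where "u = (\<lambda>i. sign_of (y $ i))"
  note r = root_eval_sign_of[of _ y, folded u_def]
  have s: "sv_support (config_covector B_config y) = {v \<in> B_config. y \<bullet> v \<noteq> 0}"
    by (auto simp: sv_support_def config_covector_def sign_of_def)
  have "u \<noteq> 0"
  proof
    assume "u = 0"
    then have "sign_of (y $ i) = 0" for i by (simp add: u_def fun_eq_iff)
    then have "y $ i = 0" for i by (metis less_numeral_extra(3) linorder_neqE sign_of_def zero_neq_neg_one zero_neq_one)
    then have "y = 0" by (simp add: vec_eq_iff)
    then show False using assms s by simp
  qed
  moreover have "sv_support (root_pattern u) \<subseteq> sv_support (config_covector B_config y)"
    unfolding s sv_support_root_pattern using r(3) by blast
  moreover have "config_covector B_config y = root_pattern u"
    if h: "sv_support (root_pattern u) = sv_support (config_covector B_config y)"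
  proof
    fix v
    have h': "root_eval v u \<noteq> 0 \<longleftrightarrow> y \<bullet> v \<noteq> 0" if "v \<in> B_config"
      using h that unfolding s sv_support_root_pattern by blast
    show "config_covector B_config y v = root_pattern u v"
    proof (cases "v \<in> B_config")
      case True
      then show ?thesis using h' r(1,2)[OF True]
        by (cases "y \<bullet> v" "0::real" rule: linorder_cases)
          (auto simp: config_covector_def root_pattern_def sign_of_def sgn_if)
    next
      case False
      then show ?thesis by (simp add: config_covector_def root_pattern_def)
    qed
  qed
  ultimately show thesis using that ternary_sign_of unfolding u_def by blast
qed

text \<open>Every nonzero covector lies above the pattern of its coordinate signs, and patterns of
  sign vectors have comparable supports only if they are equal or opposite.\<close>

lemma B_cocircuits_eq: "B_cocircuits = root_pattern ` {x. ternary x \<and> x \<noteq> 0}"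
proof (intro set_eqI iffI)
  fix C :: "(real, 'a) vec \<Rightarrow> int" assume "C \<in> B_cocircuits"
  then obtain y where y: "C = config_covector B_config y" "sv_support C \<noteq> {}"
    and min: "\<And>Y. Y \<in> range (config_covector B_config) \<Longrightarrow> sv_support Y \<noteq> {}
      \<Longrightarrow> \<not> sv_support Y \<subset> sv_support C"
    unfolding B_cocircuits_def config_cocircuits_def minimal_sign_vectors_def by blast
  obtain u where u: "ternary u" "u \<noteq> 0" "sv_support (root_pattern u) \<subseteq> sv_support C"
    "sv_support (root_pattern u) = sv_support C \<Longrightarrow> C = root_pattern u"
    using covector_above_ternary y by metis
  have "sv_support (root_pattern u) \<noteq> {}"
    using root_pattern_nonzero[OF u(2)] unfolding sv_support_root_pattern by blast
  then have "\<not> sv_support (root_pattern u) \<subset> sv_support C"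
    using min root_pattern_config_covector by blast
  then show "C \<in> root_pattern ` {x. ternary x \<and> x \<noteq> 0}" using u by blast
next
  fix C :: "(real, 'a) vec \<Rightarrow> int" assume "C \<in> root_pattern ` {x. ternary x \<and> x \<noteq> 0}"
  then obtain x where x: "ternary x" "x \<noteq> 0" "C = root_pattern x" by blast
  have ne: "sv_support C \<noteq> {}"
    using root_pattern_nonzero[OF x(2)] unfolding sv_support_root_pattern x(3) by blast
  have "\<not> sv_support Y \<subset> sv_support C"
    if Y: "Y \<in> range (config_covector B_config)" "sv_support Y \<noteq> {}" for Y
  proof
    assume l: "sv_support Y \<subset> sv_support C"
    obtain y where y: "Y = config_covector B_config y" using Y(1) by blast
    obtain u where u: "ternary u" "u \<noteq> 0" "sv_support (root_pattern u) \<subseteq> sv_support Y"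
      using covector_above_ternary[of y] Y(2) unfolding y by metis
    then have "u = x \<or> u = - x" using root_pattern_support_le x l by blast
    then have "sv_support (root_pattern u) = sv_support C"
      using x(3) sv_support_root_pattern_uminus by metis
    then show False using u(3) l by blast
  qed
  moreover have "C \<in> range (config_covector B_config)"
    unfolding x(3) root_pattern_config_covector by (rule rangeI)
  ultimately show "C \<in> B_cocircuits"
    using ne unfolding B_cocircuits_def config_cocircuits_def minimal_sign_vectors_def by simp
qed

text \<open>The roots \<open>axis i 1\<close> recover the coordinates, so the definite description
  in \<open>induced_sign\<close> has exactly one solution.\<close>

lemma represents_root_pattern:
  assumes "ternary x" "x \<noteq> 0"
  shows "(THE X. X \<in> sign_vectors UNIV \<and> sv_support X \<noteq> {} \<and> represents X (root_pattern x)) = x"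
proof (rule the_equality)
  have "sgn (x i) = x i" for i using ternaryD[OF assms(1), of i] by auto
  then show "x \<in> sign_vectors UNIV \<and> sv_support x \<noteq> {} \<and> represents x (root_pattern x)"
    using assms ternaryD[OF assms(1)]
    by (auto simp: sign_vectors_def sv_support_def fun_eq_iff represents_def root_pattern_def
        B_config_single B_config_plus B_config_minus root_eval_axis root_eval_axis_plus
        root_eval_axis_minus)
next
  fix X assume "X \<in> sign_vectors UNIV \<and> sv_support X \<noteq> {} \<and> represents X (root_pattern x)"
  then have "X i = root_pattern x (axis i 1)" for i by (simp add: represents_def)
  then have "X i = sgn (x i)" for i by (simp add: root_pattern_def B_config_single root_eval_axis)
  moreover have "sgn (x i) = x i" for i using ternaryD[OF assms(1), of i] by auto
  ultimately show "X = x" by auto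
qed

lemma induced_sign_root_pattern:
  "ternary x \<Longrightarrow> x \<noteq> 0 \<Longrightarrow> induced_sign prec (root_pattern x) = order_sign prec x"
  by (simp add: induced_sign_def represents_root_pattern)

section \<open>The constructed set is a one-element extension\<close>

context sign_order
begin

text \<open>Eliminating the new element is \<open>zero_between\<close>. At a root the signs
  \<open>s\<close>, \<open>t\<close> decide: equal weak signs need a vertex of that weak sign, two
  zeros need a zero again, and opposite signs leave the value at the new element free.\<close>

lemma extension_elimination:
  assumes a: "ext_vector a s" and b: "ext_vector b t" and ne: "\<not> (a = - b \<and> s = - t)"
    and ne0: "\<not> (root_pattern a = - root_pattern b \<and> s = - t)"
    and e: "adjoin_sign (root_pattern a) s e = 1" "adjoin_sign (root_pattern b) t e = - 1"
  shows "\<exists>c u. ext_vector c u \<and> between a b c \<and> (u > 0 \<longrightarrow> s > 0 \<or> t > 0) \<and>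
    (u < 0 \<longrightarrow> s < 0 \<or> t < 0) \<and> adjoin_sign (root_pattern c) u e = 0"
proof (cases e)
  case None
  then have st: "s = 1" "t = - 1" using e by simp_all
  have va: "ternary a" "a \<noteq> 0" "m a = 1" using a st by (auto elim: ext_vector_cases)
  have vb: "ternary b" "b \<noteq> 0" "m b = - 1" using b st by (auto elim: ext_vector_cases)
  have "a \<noteq> - b" using ne st by simp
  then obtain c where "ext_vector c 0" "between a b c"
    using zero_between[OF va(1,2) vb(1,2)] va(3) vb(3) by auto
  then show ?thesis using None by force
next
  case (Some v)
  then have v: "v \<in> B_config" "root_eval v a > 0" "root_eval v b < 0"
    using e by (simp_all add: root_pattern_pos root_pattern_neg)
  consider (pos) "s \<ge> 0" "t \<ge> 0" "s > 0 \<or> t > 0" | (neg) "s \<le> 0" "t \<le> 0" "s < 0 \<or> t < 0"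
    | (zero) "s = 0" "t = 0" | (mixed) "s > 0" "t < 0" | (mixed') "s < 0" "t > 0"
    by linarith
  then show ?thesis
  proof cases
    case pos
    obtain w where w: "ternary w" "w \<noteq> 0" "m w \<ge> 0" "root_eval v w = 0" "between a b w"
      by (rule covector_elimination[OF a b pos(1,2) v ne])
    then show ?thesis using pos(3) Some ext_vector_vertex[OF w(1,2)]
      by (intro exI[of _ w] exI[of _ "m w"]) (simp add: root_pattern_zero)
  next
    case neg
    obtain w where w: "ternary w" "w \<noteq> 0" "m w \<le> 0" "root_eval v w = 0" "between a b w"
      by (rule covector_elimination_nonpos[OF a b neg(1,2) v ne])
    then show ?thesis using neg(3) Some ext_vector_vertex[OF w(1,2)]
      by (intro exI[of _ w] exI[of _ "m w"]) (simp add: root_pattern_zero)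
  next
    case zero
    then have "root_pattern a \<noteq> - root_pattern b" using ne0 by simp
    then obtain c where c: "ext_vector c 0" "root_eval v c = 0" "between a b c"
      using zero_elimination[OF a[unfolded zero] b[unfolded zero] v] by metis
    then show ?thesis using Some
      by (intro exI[of _ c] exI[of _ 0]) (simp add: root_pattern_zero)
  next
    case mixed
    \<comment> \<open>A nonzero sign at the new element occurs only for vertices, and every sign is
      admissible for the result, so elimination for the zero sign function suffices.\<close>
    then have vs: "ternary a" "s = m a" "ternary b" "t = m b"
      using a b by (auto elim: ext_vector_cases)
    have "a \<noteq> - b" using ne vs m_uminus[OF vs(3)] by auto
    then obtain w where w: "ternary w" "w \<noteq> 0" "root_eval v w = 0" "between a b w"
      using sign_order.vertex_elimination[OF sign_order_zero vs(1,3) _ _ _ v] by auto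
    then show ?thesis using mixed Some ext_vector_vertex[OF w(1,2)]
      by (intro exI[of _ w] exI[of _ "m w"]) (simp add: root_pattern_zero)
  next
    case mixed'
    then have vs: "ternary a" "s = m a" "ternary b" "t = m b"
      using a b by (auto elim: ext_vector_cases)
    have "a \<noteq> - b" using ne vs m_uminus[OF vs(3)] by auto
    then obtain w where w: "ternary w" "w \<noteq> 0" "root_eval v w = 0" "between a b w"
      using sign_order.vertex_elimination[OF sign_order_zero vs(1,3) _ _ _ v] by auto
    then show ?thesis using mixed' Some ext_vector_vertex[OF w(1,2)]
      by (intro exI[of _ w] exI[of _ "m w"]) (simp add: root_pattern_zero)
  qed
qed

lemma ext_vector_range: "ext_vector a s \<Longrightarrow> s = - 1 \<or> s = 0 \<or> s = 1"
  using m_range by (metis ext_vector_cases)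

lemma ext_vector_nonzero:
  assumes "ext_vector a s" shows "\<exists>v\<in>B_config. root_eval v a \<noteq> 0"
  using assms
proof (cases rule: ext_vector_cases)
  case vertex
  then show ?thesis using root_pattern_nonzero by blast
next
  case (edge x y)
  obtain v where "v \<in> B_config" "root_eval v x \<noteq> 0"
    using root_pattern_nonzero m_opposite(4)[OF edge(5)] by blast
  then show ?thesis using between_zero[OF between_conformal_sum(1)[OF edge(2-4)]] edge(6) by blast
qed

lemma extension_incomparable:
  assumes a: "ext_vector a s" and b: "ext_vector b t"
    and sub: "sv_support (adjoin_sign (root_pattern a) s) \<subseteq> sv_support (adjoin_sign (root_pattern b) t)"
  shows "a = b \<and> s = t \<or> a = - b \<and> s = - t"
proof -
  have h: "adjoin_sign (root_pattern b) t e = 0 \<Longrightarrow> adjoin_sign (root_pattern a) s e = 0" for e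
    using sub by (auto simp: sv_support_def)
  have z: "\<forall>v\<in>B_config. root_eval v b = 0 \<longrightarrow> root_eval v a = 0"
  proof (intro ballI impI)
    fix v assume "v \<in> B_config" "root_eval v b = 0"
    then show "root_eval v a = 0" using h[of "Some v"] by (simp add: root_pattern_zero)
  qed
  have st: "t = 0 \<Longrightarrow> s = 0" using h[of None] by simp
  show ?thesis using b
  proof (cases rule: ext_vector_cases)
    case vertex
    then show ?thesis using support_below_vertex[OF a vertex(1,2) z] by simp
  next
    case (edge x y)
    then show ?thesis using support_below_edge[OF a edge(2-5)] z st by simp
  qed
qed

lemma oriented_matroid_extension: "oriented_matroid (ext_ground B_config) extension"
  unfolding oriented_matroid_def
proof (intro conjI ballI impI)
  show "finite (ext_ground B_config)" by (simp add: ext_ground_def finite_B_config)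
  show "extension \<subseteq> sign_vectors (ext_ground B_config)"
  proof
    fix X assume "X \<in> extension"
    then obtain a s where X: "X = adjoin_sign (root_pattern a) s" "ext_vector a s"
      by (auto simp: extension_def)
    have "X e \<in> {- 1, 0, 1}" for e
      using ext_vector_range[OF X(2)] unfolding X(1)
      by (cases e) (auto simp: root_pattern_def sgn_if)
    moreover have "X e = 0" if "e \<notin> ext_ground B_config" for e
      using that unfolding X(1) by (cases e) (auto simp: ext_ground_def root_pattern_def)
    ultimately show "X \<in> sign_vectors (ext_ground B_config)" by (simp add: sign_vectors_def)
  qed
next
  fix X assume "X \<in> extension"
  then obtain a s where X: "X = adjoin_sign (root_pattern a) s" "ext_vector a s"
    by (auto simp: extension_def)
  obtain v where "v \<in> B_config" "root_eval v a \<noteq> 0" using ext_vector_nonzero[OF X(2)] by blast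
  then have "X (Some v) \<noteq> 0" by (simp add: X(1) root_pattern_zero)
  then show "sv_support X \<noteq> {}" by (auto simp: sv_support_def)
  show "- X \<in> extension"
    using ext_vector_uminus[OF X(2)] unfolding X(1) adjoin_sign_uminus extension_def
    by (auto simp: root_pattern_uminus[symmetric])
next
  fix X Y assume "X \<in> extension" "Y \<in> extension" and sub: "sv_support X \<subseteq> sv_support Y"
  then obtain a s b t where X: "X = adjoin_sign (root_pattern a) s" "ext_vector a s"
    and Y: "Y = adjoin_sign (root_pattern b) t" "ext_vector b t"
    by (auto simp: extension_def)
  show "X = Y \<or> X = - Y"
    using extension_incomparable[OF X(2) Y(2)] sub unfolding X(1) Y(1) adjoin_sign_uminus
    by (auto simp: root_pattern_uminus)
next
  fix X Y e assume "X \<in> extension" "Y \<in> extension" and ne: "X \<noteq> - Y" and e: "e \<in> pos_part X \<inter> neg_part Y"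
  then obtain a s b t where X: "X = adjoin_sign (root_pattern a) s" "ext_vector a s"
    and Y: "Y = adjoin_sign (root_pattern b) t" "ext_vector b t"
    by (auto simp: extension_def)
  have ne0: "\<not> (root_pattern a = - root_pattern b \<and> s = - t)"
    using ne unfolding X(1) Y(1) adjoin_sign_uminus by auto
  then have ne1: "\<not> (a = - b \<and> s = - t)" using root_pattern_uminus by blast
  have e': "adjoin_sign (root_pattern a) s e = 1" "adjoin_sign (root_pattern b) t e = - 1"
    using e X(1) Y(1) by (auto simp: pos_part_def neg_part_def)
  obtain c u where c: "ext_vector c u" "between a b c" "u > 0 \<longrightarrow> s > 0 \<or> t > 0"
    "u < 0 \<longrightarrow> s < 0 \<or> t < 0" "adjoin_sign (root_pattern c) u e = 0"
    using extension_elimination[OF X(2) Y(2) ne1 ne0 e'] by blast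
  have r: "s = - 1 \<or> s = 0 \<or> s = 1" "t = - 1 \<or> t = 0 \<or> t = 1"
    using ext_vector_range X(2) Y(2) by blast+
  let ?Z = "adjoin_sign (root_pattern c) u"
  have "?Z f = 1 \<longrightarrow> X f = 1 \<or> Y f = 1" "?Z f = - 1 \<longrightarrow> X f = - 1 \<or> Y f = - 1" for f
  proof -
    have "(?Z f = 1 \<longrightarrow> X f = 1 \<or> Y f = 1) \<and> (?Z f = - 1 \<longrightarrow> X f = - 1 \<or> Y f = - 1)"
    proof (cases f)
      case None
      then show ?thesis using c(3,4) r X(1) Y(1) by auto
    next
      case (Some v)
      then show ?thesis using c(2) unfolding X(1) Y(1) between_def
        by (simp add: root_pattern_pos root_pattern_neg)
    qed
    then show "?Z f = 1 \<longrightarrow> X f = 1 \<or> Y f = 1" "?Z f = - 1 \<longrightarrow> X f = - 1 \<or> Y f = - 1" by blast+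
  qed
  moreover have "?Z \<in> extension" using c(1) by (auto simp: extension_def)
  ultimately show "\<exists>Z\<in>extension. pos_part Z \<subseteq> pos_part X \<union> pos_part Y - {e} \<and>
      neg_part Z \<subseteq> neg_part X \<union> neg_part Y - {e}"
    using c(5) by (intro bexI[of _ ?Z]) (auto simp: pos_part_def neg_part_def)
qed

lemma adjoin_sign_comp_Some: "adjoin_sign C s \<circ> Some = C"
  by (simp add: fun_eq_iff)

lemma extension_vertex:
  "ternary x \<Longrightarrow> x \<noteq> 0 \<Longrightarrow> adjoin_sign (root_pattern x) (m x) \<in> extension"
  unfolding extension_def using ext_vector_vertex by blast

text \<open>Deletion must discard the edge vectors: if an end \<open>x\<close> had the full support
  of its edge, the support of \<open>y\<close> would lie below that of \<open>x\<close>, making the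
  ends equal or opposite.\<close>

lemma restrict_extension: "restrict_to_old extension = B_cocircuits"
proof (intro set_eqI iffI)
  fix C assume C: "C \<in> restrict_to_old extension"
  then obtain Y where Y: "Y \<in> extension" "C = Y \<circ> Some" by (rule restrict_to_oldE)
  then obtain a s where a: "C = root_pattern a" "ext_vector a s"
    unfolding extension_def using adjoin_sign_comp_Some by blast
  have min: "\<not> sv_support (root_pattern b) \<subset> sv_support C" if "ext_vector b t" for b t
  proof -
    have "root_pattern b \<in> (\<lambda>Y. Y \<circ> Some) ` extension"
      using that adjoin_sign_comp_Some unfolding extension_def image_def by (auto intro!: exI)
    moreover have "sv_support (root_pattern b) \<noteq> {}"
      using ext_vector_nonzero[OF that] by (auto simp: sv_support_root_pattern)
    ultimately show ?thesis using C unfolding restrict_to_old_def minimal_sign_vectors_def by blast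
  qed
  show "C \<in> B_cocircuits" using a(2)
  proof (cases rule: ext_vector_cases)
    case vertex
    then show ?thesis using a(1) by (auto simp: B_cocircuits_eq)
  next
    case (edge x y)
    note o = m_opposite[OF edge(5)]
    note b = between_conformal_sum[OF edge(2-4), folded edge(6)]
    have sub: "sv_support (root_pattern x) \<subseteq> sv_support C" "sv_support (root_pattern y) \<subseteq> sv_support C"
      unfolding a(1) sv_support_root_pattern using between_zero b by blast+
    moreover have "\<not> sv_support (root_pattern x) \<subset> sv_support C"
      using min ext_vector_vertex[OF edge(2) o(4)] by blast
    ultimately have "sv_support (root_pattern y) \<subseteq> sv_support (root_pattern x)" by blast
    then have "y = x \<or> y = - x" using root_pattern_support_le edge(2,3) o(4,5) by blast
    then have "x = - y" using o(3) by auto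
    then have False using conformal_le_not_opposite[OF edge(4) o(4)] by blast
    then show ?thesis ..
  qed
next
  fix C :: "(real, 'n) vec \<Rightarrow> int" assume "C \<in> B_cocircuits"
  then obtain x where x: "ternary x" "x \<noteq> 0" "C = root_pattern x" by (auto simp: B_cocircuits_eq)
  have ne: "sv_support C \<noteq> {}"
    using root_pattern_nonzero[OF x(2)] by (auto simp: x(3) sv_support_root_pattern)
  have "\<not> sv_support (Y \<circ> Some) \<subset> sv_support C" if Y: "Y \<in> extension" for Y
  proof
    assume l: "sv_support (Y \<circ> Some) \<subset> sv_support C"
    obtain a s where a: "Y = adjoin_sign (root_pattern a) s" "ext_vector a s"
      using Y by (auto simp: extension_def)
    have l': "sv_support (root_pattern a) \<subset> sv_support (root_pattern x)"
      using l unfolding a(1) adjoin_sign_comp_Some x(3) .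
    then have "a = x \<or> a = - x"
      using support_below_vertex[OF a(2) x(1,2)] unfolding sv_support_root_pattern by blast
    then show False using l' sv_support_root_pattern_uminus by (metis psubset_eq)
  qed
  moreover have "C \<in> (\<lambda>Y. Y \<circ> Some) ` extension"
    using imageI[OF extension_vertex[OF x(1,2)], of "\<lambda>Y. Y \<circ> Some"]
    unfolding adjoin_sign_comp_Some x(3) .
  ultimately show "C \<in> restrict_to_old extension"
    using ne unfolding restrict_to_old_def minimal_sign_vectors_def by blast
qed

lemma extension_in_one_element_extensions:
  "extension \<in> one_element_extensions B_config B_cocircuits"
proof -
  have nonempty: "sv_support (Z \<circ> Some) \<noteq> {}" if Z: "Z \<in> extension" for Z
  proof -
    obtain a s where a: "Z = adjoin_sign (root_pattern a) s" "ext_vector a s"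
      using Z by (auto simp: extension_def)
    show ?thesis
      using ext_vector_nonzero[OF a(2)] unfolding a(1) adjoin_sign_comp_Some sv_support_root_pattern
      by blast
  qed
  have "om_rank (ext_ground B_config) extension = om_rank B_config (restrict_to_old extension)"
    using no_coloop_imp_same_rank[OF oriented_matroid_extension nonempty] .
  then show ?thesis
    using oriented_matroid_extension restrict_extension by (simp add: one_element_extensions_def)
qed

section \<open>Uniqueness of the extension inducing a sign function\<close>

text \<open>Eliminating the new element between the ends gives a cocircuit \<open>Z\<close> whose
  sign at each root is that of \<open>x + y\<close> or zero. If it lost a root \<open>v\<close>, its
  support would lie below that of a vertex vector of nonzero value, against incomparability.\<close>

lemma edge_in_localization_extension:
  assumes D': "D' \<in> one_element_extensions B_config B_cocircuits"
    and vertices: "\<And>x. ternary x \<Longrightarrow> x \<noteq> 0 \<Longrightarrow> adjoin_sign (root_pattern x) (m x) \<in> D'"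
    and x: "ternary x" and y: "ternary y" and xy: "conformal_le x y" and mxy: "m x * m y < 0"
  shows "adjoin_sign (root_pattern (x + y)) 0 \<in> D'"
proof -
  note o = m_opposite[OF mxy]
  note b = between_conformal_sum[OF x y xy]
  have om: "oriented_matroid (ext_ground B_config) D'" and r: "restrict_to_old D' = B_cocircuits"
    using D' by (auto simp: one_element_extensions_def)
  let ?X = "adjoin_sign (root_pattern x) (m x)" and ?Y = "adjoin_sign (root_pattern y) (m y)"
  have XY: "?X \<in> D'" "?Y \<in> D'" using vertices x y o(4,5) by blast+
  have neXY: "?X \<noteq> - ?Y"
  proof
    assume "?X = - ?Y"
    then have "root_pattern x = root_pattern (- y)"
      by (simp add: adjoin_sign_uminus adjoin_sign_inject root_pattern_uminus)
    then have "x = - y" using root_pattern_inj x ternary_uminus[OF y] by blast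
    then show False using conformal_le_not_opposite[OF xy o(4)] by blast
  qed
  then have neYX: "?Y \<noteq> - ?X" by (metis minus_minus)
  obtain Z where Z: "Z \<in> D'" "pos_part Z \<subseteq> (pos_part ?X \<union> pos_part ?Y) - {None}"
    "neg_part Z \<subseteq> (neg_part ?X \<union> neg_part ?Y) - {None}"
  proof (cases "m x = 1")
    case True
    then have "?X None = 1" "?Y None = - 1" using o(2) by simp_all
    then show thesis using om_elimination[OF om XY neXY] that by metis
  next
    case False
    then have "?Y None = 1" "?X None = - 1" using o(1,2) m_range[of x] by auto
    then show thesis using om_elimination[OF om XY(2,1) neYX] that by (metis Un_commute)
  qed
  have sign: "Z e = - 1 \<or> Z e = 0 \<or> Z e = 1" for e using om_sign[OF om Z(1)] .
  have ZNone: "Z None = 0"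
    using Z(2,3) sign[of None] by (auto simp: pos_part_def neg_part_def)
  have Zpos: "v \<in> B_config \<and> root_eval v (x + y) > 0" if h: "Z (Some v) = 1" for v
  proof -
    have "root_pattern x v = 1 \<or> root_pattern y v = 1" using Z(2) h by (auto simp: pos_part_def)
    then show ?thesis using b unfolding root_pattern_pos between_def by blast
  qed
  have Zneg: "v \<in> B_config \<and> root_eval v (x + y) < 0" if h: "Z (Some v) = - 1" for v
  proof -
    have "root_pattern x v = - 1 \<or> root_pattern y v = - 1" using Z(3) h by (auto simp: neg_part_def)
    then show ?thesis using b unfolding root_pattern_neg between_def by blast
  qed
  have Zout: "Z (Some v) = 0" if "v \<notin> B_config \<or> root_eval v (x + y) = 0" for v
    using sign[of "Some v"] Zpos[of v] Zneg[of v] that by auto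
  let ?z = "\<lambda>p q i. p * x i + q * (y i - x i)"
  \<comment> \<open>Each old element in the support of \<open>Z\<close> is covered by a vertex in
    the plane of the edge, and by \<open>m_plane\<close> such a vertex has nonzero value.\<close>
  have cover: "\<exists>p q. p \<in> {- 1, 0, 1} \<and> q \<in> {- 1, 0, 1} \<and> ternary (?z p q) \<and> ?z p q \<noteq> 0 \<and>
      m (?z p q) \<noteq> 0 \<and> root_eval e (?z p q) \<noteq> 0 \<and>
      sv_support (root_pattern (?z p q)) \<subseteq> sv_support (Z \<circ> Some)" if e: "Z (Some e) \<noteq> 0" for e
  proof -
    obtain C where C: "C \<in> B_cocircuits" "C e \<noteq> 0" "sv_support C \<subseteq> sv_support (Z \<circ> Some)"
      using restriction_covered[OF om Z(1) e] r by metis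
    obtain w where w: "C = root_pattern w" "ternary w" "w \<noteq> 0"
      using C(1) by (auto simp: B_cocircuits_eq)
    have "\<forall>v\<in>B_config. root_eval v (x + y) = 0 \<longrightarrow> root_eval v w = 0"
    proof (intro ballI impI)
      fix v assume v: "v \<in> B_config" "root_eval v (x + y) = 0"
      then have "v \<notin> sv_support (Z \<circ> Some)" using Zout by (simp add: sv_support_def)
      then have "v \<notin> sv_support (root_pattern w)" using C(3) w(1) by blast
      then show "root_eval v w = 0" using v(1) by (simp add: sv_support_root_pattern)
    qed
    then obtain p q where pq: "p \<in> {- 1, 0, 1}" "q \<in> {- 1, 0, 1}" "w = ?z p q"
      using plane_combination[OF x o(4) y o(3) xy w(2)] by metis
    have "m w \<noteq> 0"
    proof
      assume "m w = 0"
      then have "2 * p = 3 * q"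
        using m_plane[OF x y xy mxy pq(1,2)] pq(3) o(1) by (simp add: sgn_if split: if_splits)
      then have "p = 0" "q = 0" using pq(1,2) by auto
      then show False using w(3) pq(3) by (simp add: fun_eq_iff)
    qed
    moreover have "root_eval e w \<noteq> 0" using C(2) w(1) by (simp add: root_pattern_zero)
    ultimately show ?thesis using pq w C(3) by blast
  qed
  have full: "Z (Some v) \<noteq> 0" if v: "v \<in> B_config" "root_eval v (x + y) \<noteq> 0" for v
  proof
    assume Zv: "Z (Some v) = 0"
    have lin: "root_eval u (?z p q) = (p - q) * root_eval u x + q * root_eval u y" for u p q
    proof -
      have "?z p q = (\<lambda>i. (p - q) * x i + q * y i)" by (simp add: fun_eq_iff algebra_simps)
      then show ?thesis by (simp add: root_eval_lincomb)
    qed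
    have van: "root_eval v (?z p q) = 0"
      if "sv_support (root_pattern (?z p q)) \<subseteq> sv_support (Z \<circ> Some)" for p q
    proof -
      have "v \<notin> sv_support (Z \<circ> Some)" using Zv by (simp add: sv_support_def)
      then show ?thesis using that v(1) unfolding sv_support_root_pattern by blast
    qed
    obtain e where "Z e \<noteq> 0" using om_support_nonempty[OF om Z(1)] by (auto simp: sv_support_def)
    then obtain e' where "Z (Some e') \<noteq> 0" using ZNone by (cases e) auto
    then obtain p q where pq: "p \<in> {- 1, 0, 1}" "q \<in> {- 1, 0, 1}" "ternary (?z p q)" "?z p q \<noteq> 0"
      "m (?z p q) \<noteq> 0" "sv_support (root_pattern (?z p q)) \<subseteq> sv_support (Z \<circ> Some)"
      using cover by blast
    let ?W = "adjoin_sign (root_pattern (?z p q)) (m (?z p q))"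
    \<comment> \<open>All covering vertices vanish at \<open>v\<close>, hence are proportional
      within the plane, so a single one covers the whole support of \<open>Z\<close>.\<close>
    have "sv_support Z \<subseteq> sv_support ?W"
    proof
      fix e assume "e \<in> sv_support Z"
      then have Ze: "Z e \<noteq> 0" by (simp add: sv_support_def)
      then obtain u where u: "e = Some u" using ZNone by (cases e) auto
      obtain p' q' where pq': "root_eval u (?z p' q') \<noteq> 0"
        "sv_support (root_pattern (?z p' q')) \<subseteq> sv_support (Z \<circ> Some)"
        using cover Ze u by blast
      have uB: "u \<in> B_config" using Ze u Zout by blast
      have "root_eval u (?z p q) \<noteq> 0"
      proof
        assume u0: "root_eval u (?z p q) = 0"
        let ?a = "root_eval v x" and ?b = "root_eval v y" and ?c = "root_eval u x" and ?d = "root_eval u y"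
        have eq: "(p - q) * ?a + q * ?b = 0" "(p - q) * ?c + q * ?d = 0" "(p' - q') * ?a + q' * ?b = 0"
          using van[OF pq(6)] van[OF pq'(2)] u0 unfolding lin by blast+
        have pq0: "p - q \<noteq> 0 \<or> q \<noteq> 0" using pq(4) by (auto simp: fun_eq_iff)
        have ab: "?a \<noteq> 0 \<or> ?b \<noteq> 0" using v(2) by (auto simp: root_eval_add)
        \<comment> \<open>\<open>u\<close> and \<open>v\<close> annihilate the same nonzero vector
          of the plane, so their values at \<open>x\<close> and \<open>y\<close> are proportional;
          \<open>v\<close> is nonzero on the plane, so \<open>u\<close> also annihilates the second
          vertex.\<close>
        have "(p - q) * (?a * ?d - ?b * ?c) = 0" "q * (?a * ?d - ?b * ?c) = 0"
          using eq(1,2) by algebra+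
        then have det: "?a * ?d - ?b * ?c = 0" using pq0 by auto
        have "?a * ((p' - q') * ?c + q' * ?d) = 0" "?b * ((p' - q') * ?c + q' * ?d) = 0"
          using eq(3) det by algebra+
        then have "(p' - q') * ?c + q' * ?d = 0" using ab by auto
        then show False using pq'(1) unfolding lin by blast
      qed
      then show "e \<in> sv_support ?W" using u uB by (simp add: sv_support_def root_pattern_zero)
    qed
    then have "Z = ?W \<or> Z = - ?W" using om_incomparable[OF om Z(1) vertices[OF pq(3,4)]] by blast
    then have "Z None = m (?z p q) \<or> Z None = - m (?z p q)" by auto
    then show False using ZNone pq(5) by simp
  qed
  have "Z = adjoin_sign (root_pattern (x + y)) 0"
  proof
    fix e
    show "Z e = adjoin_sign (root_pattern (x + y)) 0 e"
    proof (cases e)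
      case None
      then show ?thesis using ZNone by simp
    next
      case (Some v)
      show ?thesis
      proof (cases "v \<in> B_config \<and> root_eval v (x + y) \<noteq> 0")
        case True
        then show ?thesis
          using full[of v] Zpos[of v] Zneg[of v] sign[of "Some v"] Some
          by (auto simp: root_pattern_def)
      next
        case False
        then show ?thesis using Zout[of v] Some by (auto simp: root_pattern_def)
      qed
    qed
  qed
  then show ?thesis using Z(1) by simp
qed

text \<open>Existence and uniqueness at once: an extension inducing \<open>m\<close> contains the
  vertex vectors by definition and the edge vectors by
  \<open>edge_in_localization_extension\<close>, and inclusion between extensions is
  equality.\<close>

lemma localization_extension_iff:
  assumes \<sigma>: "\<And>x. ternary x \<Longrightarrow> x \<noteq> 0 \<Longrightarrow> \<sigma> (root_pattern x) = m x"
  shows "localization_extension B_config B_cocircuits \<sigma> D' \<longleftrightarrow> D' = extension"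
proof
  assume "D' = extension"
  then show "localization_extension B_config B_cocircuits \<sigma> D'"
    using extension_in_one_element_extensions extension_vertex \<sigma>
    by (auto simp: localization_extension_def B_cocircuits_eq)
next
  assume l: "localization_extension B_config B_cocircuits \<sigma> D'"
  then have D': "D' \<in> one_element_extensions B_config B_cocircuits"
    by (simp add: localization_extension_def)
  have v: "adjoin_sign (root_pattern x) (m x) \<in> D'" if "ternary x" "x \<noteq> 0" for x
    using l that \<sigma>[OF that] by (force simp: localization_extension_def B_cocircuits_eq)
  have "extension \<subseteq> D'"
  proof
    fix Z assume "Z \<in> extension"
    then obtain a s where a: "Z = adjoin_sign (root_pattern a) s" "ext_vector a s"
      by (auto simp: extension_def)
    show "Z \<in> D'" using a(2)
    proof (cases rule: ext_vector_cases)
      case vertex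
      then show ?thesis using v a(1) by simp
    next
      case (edge x y)
      then show ?thesis
        using edge_in_localization_extension[OF D' v edge(2-5)] a(1) by simp
    qed
  qed
  then show "D' = extension"
    using one_element_extension_maximal[OF extension_in_one_element_extensions D'] by simp
qed

end

section \<open>Sign functions of generalized partial term orders\<close>

text \<open>For additivity, \<open>x\<close>, \<open>y\<close> and \<open>x + y\<close> are placed
  on a chain \<open>A\<close>, \<open>B\<close>, \<open>C\<close>: by condition (1) they encode the
  comparisons of \<open>A\<close> with \<open>B\<close>, of \<open>B\<close> with \<open>C\<close>
  and of \<open>A\<close> with \<open>C\<close>.\<close>

lemma sign_order_order_sign:
  fixes prec :: "'n::{finite,linorder} set \<Rightarrow> 'n set \<Rightarrow> bool"
  assumes "generalized_partial_term_order prec"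
  shows "sign_order (order_sign prec)"
proof -
  note d = assms[unfolded generalized_partial_term_order_def]
  have irr: "\<not> prec A A" for A
    using d[THEN conjunct1] by (rule irreflpD)
  have tr: "prec A B \<Longrightarrow> prec B C \<Longrightarrow> prec A C" for A B C
    using d[THEN conjunct2, THEN conjunct1] by (rule transpD)
  have add: "prec A B \<longleftrightarrow> prec (A \<union> G) (B \<union> G)" if "G \<inter> (A \<union> B) = {}" for A B G
    using d[THEN conjunct2, THEN conjunct2, THEN conjunct1] that by blast
  have inc: "{C. prec C A} = {C. prec C B} \<and> {C. prec A C} = {C. prec B C}"
    if "\<not> prec A B" "\<not> prec B A" for A B
    using d[THEN conjunct2, THEN conjunct2, THEN conjunct2] that by blast
  have asym: "prec A B \<Longrightarrow> \<not> prec B A" for A B using irr tr by blast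
  \<comment> \<open>By condition (2) incomparable sets have the same sets above and below them, so
    the weak relation \<open>\<not> prec B A\<close> is transitive.\<close>
  have le_trans: "\<not> prec C A" if "\<not> prec B A" "\<not> prec C B" for A B C
  proof
    assume "prec C A"
    then show False using that tr[of C A B] inc[of A B] by blast
  qed
  have le_less_trans: "prec A C" if "\<not> prec B A" "prec B C" for A B C
    using that tr[of A B C] inc[of A B] by blast
  have pos: "order_sign prec x > 0 \<longleftrightarrow> prec (neg_part x) (pos_part x)"
    and nonneg: "order_sign prec x \<ge> 0 \<longleftrightarrow> \<not> prec (pos_part x) (neg_part x)" for x :: "'n \<Rightarrow> int"
    using asym by (auto simp: order_sign_def)
  have chain: "\<exists>A B C. (prec (neg_part x) (pos_part x) \<longleftrightarrow> prec A B) \<and>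
      (prec (pos_part x) (neg_part x) \<longleftrightarrow> prec B A) \<and>
      (prec (neg_part y) (pos_part y) \<longleftrightarrow> prec B C) \<and> (prec (pos_part y) (neg_part y) \<longleftrightarrow> prec C B) \<and>
      (prec (neg_part (x + y)) (pos_part (x + y)) \<longleftrightarrow> prec A C) \<and>
      (prec (pos_part (x + y)) (neg_part (x + y)) \<longleftrightarrow> prec C A)"
    if t: "ternary x" "ternary y" "ternary (x + y)" for x y :: "'n \<Rightarrow> int"
  proof -
    \<comment> \<open>\<open>B\<close> is the union of \<open>pos_part x\<close> and
      \<open>neg_part y\<close>; \<open>G1\<close> and \<open>G2\<close> complete these two sets to
      \<open>B\<close>. \<open>G3\<close> is the common part of \<open>A\<close> and
      \<open>C\<close>, which cancels in \<open>x + y\<close>.\<close>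
    define G1 where "G1 = {i. x i = 0 \<and> y i = - 1}"
    define G2 where "G2 = {i. x i = 1 \<and> y i = 0}"
    define G3 where "G3 = {i. x i = - 1 \<and> y i = 1}"
    have s: "(x i, y i) \<in> {(- 1, 0), (- 1, 1), (0, - 1), (0, 0), (0, 1), (1, - 1), (1, 0)}" for i
      using ternaryD[OF t(1), of i] ternaryD[OF t(2), of i] ternaryD[OF t(3), of i] by auto
    have e: "neg_part y \<union> G2 = pos_part x \<union> G1" "neg_part (x + y) \<union> G3 = neg_part x \<union> G1"
      "pos_part (x + y) \<union> G3 = pos_part y \<union> G2"
    proof -
      have "(i \<in> neg_part y \<union> G2 \<longleftrightarrow> i \<in> pos_part x \<union> G1) \<and>
        (i \<in> neg_part (x + y) \<union> G3 \<longleftrightarrow> i \<in> neg_part x \<union> G1) \<and>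
        (i \<in> pos_part (x + y) \<union> G3 \<longleftrightarrow> i \<in> pos_part y \<union> G2)" for i
        using s[of i] by (auto simp: neg_part_def pos_part_def G1_def G2_def G3_def)
      then show "neg_part y \<union> G2 = pos_part x \<union> G1" "neg_part (x + y) \<union> G3 = neg_part x \<union> G1"
        "pos_part (x + y) \<union> G3 = pos_part y \<union> G2" by blast+
    qed
    have d: "G1 \<inter> (neg_part x \<union> pos_part x) = {}" "G1 \<inter> (pos_part x \<union> neg_part x) = {}"
      "G2 \<inter> (neg_part y \<union> pos_part y) = {}" "G2 \<inter> (pos_part y \<union> neg_part y) = {}"
      "G3 \<inter> (neg_part (x + y) \<union> pos_part (x + y)) = {}"
      "G3 \<inter> (pos_part (x + y) \<union> neg_part (x + y)) = {}"
      by (auto simp: neg_part_def pos_part_def G1_def G2_def G3_def)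
    show ?thesis
      using add[OF d(1)] add[OF d(2)] add[OF d(3)] add[OF d(4)] add[OF d(5)] add[OF d(6)]
      unfolding e by blast
  qed
  show ?thesis
  proof
    fix x y :: "'n \<Rightarrow> int"
    show "order_sign prec x = - 1 \<or> order_sign prec x = 0 \<or> order_sign prec x = 1"
      by (simp add: order_sign_def)
    have "neg_part (- x) = pos_part x" "pos_part (- x) = neg_part x"
      by (auto simp: neg_part_def pos_part_def)
    then show "ternary x \<Longrightarrow> order_sign prec (- x) = - order_sign prec x"
      using asym by (simp add: order_sign_def)
    show "order_sign prec (x + y) \<ge> 0"
      if "ternary x" "ternary y" "ternary (x + y)" "order_sign prec x \<ge> 0" "order_sign prec y \<ge> 0"
      using chain[OF that(1-3)] that(4,5) le_trans unfolding nonneg by blast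
    show "order_sign prec (x + y) > 0"
      if "ternary x" "ternary y" "ternary (x + y)" "order_sign prec x \<ge> 0" "order_sign prec y > 0"
      using chain[OF that(1-3)] that(4,5) le_less_trans unfolding nonneg pos by blast
  qed
qed

text \<open>Condition (1) cancels the intersection of the two sets, so every comparison is visible
  in a sign vector.\<close>

lemma order_sign_determines:
  assumes "generalized_partial_term_order prec"
  shows "prec \<alpha> \<beta> \<longleftrightarrow>
    order_sign prec (\<lambda>i. (if i \<in> \<beta> then 1 else 0) - (if i \<in> \<alpha> then 1 else 0)) = 1"
proof -
  let ?x = "\<lambda>i. (if i \<in> \<beta> then 1 else 0) - (if i \<in> \<alpha> then 1 else 0) :: int"
  have p: "pos_part ?x = \<beta> - \<alpha>" "neg_part ?x = \<alpha> - \<beta>"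
    by (auto simp: pos_part_def neg_part_def)
  have "(\<alpha> \<inter> \<beta>) \<inter> ((\<alpha> - \<beta>) \<union> (\<beta> - \<alpha>)) = {}" by blast
  then have "prec (\<alpha> - \<beta>) (\<beta> - \<alpha>) \<longleftrightarrow> prec ((\<alpha> - \<beta>) \<union> (\<alpha> \<inter> \<beta>)) ((\<beta> - \<alpha>) \<union> (\<alpha> \<inter> \<beta>))"
    using assms unfolding generalized_partial_term_order_def by blast
  moreover have "(\<alpha> - \<beta>) \<union> (\<alpha> \<inter> \<beta>) = \<alpha>" "(\<beta> - \<alpha>) \<union> (\<alpha> \<inter> \<beta>) = \<beta>" by blast+
  ultimately show ?thesis by (simp add: order_sign_def p)
qed

theorem theorem5p3:
  shows "(\<forall>prec :: 'n::{finite,linorder} set \<Rightarrow> 'n set \<Rightarrow> bool.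
            generalized_partial_term_order prec \<longrightarrow>
              is_localization B_config B_cocircuits (induced_sign prec)) \<and>
         (\<exists>S \<subseteq> one_element_extensions B_config B_cocircuits.
            bij_betw order_extension
              {prec :: 'n set \<Rightarrow> 'n set \<Rightarrow> bool. generalized_partial_term_order prec} S)"
proof -
  have iff: "localization_extension B_config B_cocircuits (induced_sign prec) D' \<longleftrightarrow>
      D' = sign_order.extension (order_sign prec)"
    if "generalized_partial_term_order prec" for prec :: "'n set \<Rightarrow> 'n set \<Rightarrow> bool" and D'
    by (intro sign_order.localization_extension_iff sign_order_order_sign that
        induced_sign_root_pattern)
  have loc: "localization_extension B_config B_cocircuits (induced_sign prec) (order_extension prec)"
    if "generalized_partial_term_order prec" for prec :: "'n set \<Rightarrow> 'n set \<Rightarrow> bool"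
    unfolding order_extension_def extension_of_def iff[OF that] by simp
  \<comment> \<open>Both orders put a vector over the cocircuit \<open>root_pattern x\<close> into
    one oriented matroid. Two such vectors have comparable supports, so they agree up to sign, and
    opposite ones would give \<open>x = - x\<close>.\<close>
  have same_sign: "order_sign prec x = order_sign prec' x"
    if g: "generalized_partial_term_order prec" "generalized_partial_term_order prec'"
      and eq: "order_extension prec = order_extension prec'" and x: "ternary x" "x \<noteq> 0"
    for prec prec' :: "'n set \<Rightarrow> 'n set \<Rightarrow> bool" and x
  proof -
    let ?X = "\<lambda>prec. adjoin_sign (root_pattern x) (order_sign prec x)"
    have ext: "?X prec \<in> order_extension prec" "?X prec' \<in> order_extension prec"
      using loc[OF g(1)] loc[OF g(2)] x induced_sign_root_pattern[OF x] unfolding eq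
      by (force simp: localization_extension_def B_cocircuits_eq)+
    have om: "oriented_matroid (ext_ground B_config) (order_extension prec)"
      using loc[OF g(1)] by (simp add: localization_extension_def one_element_extensions_def)
    have "sv_support (?X prec) \<subseteq> sv_support (?X prec') \<or> sv_support (?X prec') \<subseteq> sv_support (?X prec)"
    proof (cases "order_sign prec x = 0")
      case True
      then have "?X prec e \<noteq> 0 \<Longrightarrow> ?X prec' e \<noteq> 0" for e by (cases e) simp_all
      then show ?thesis by (auto simp: sv_support_def)
    next
      case False
      then have "?X prec' e \<noteq> 0 \<Longrightarrow> ?X prec e \<noteq> 0" for e by (cases e) simp_all
      then show ?thesis by (auto simp: sv_support_def)
    qed
    then have "?X prec = ?X prec' \<or> ?X prec = - ?X prec' \<or> ?X prec' = - ?X prec"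
      using om_incomparable[OF om] ext by metis
    moreover have "root_pattern x \<noteq> - root_pattern x"
    proof
      assume "root_pattern x = - root_pattern x"
      then have "x = - x"
        using root_pattern_inj[OF x(1) ternary_uminus[OF x(1)]] root_pattern_uminus by metis
      then have "x i = 0" for i by (metis equal_neg_zero fun_Compl_def)
      then show False using x(2) by (auto simp: fun_eq_iff)
    qed
    ultimately show ?thesis unfolding adjoin_sign_uminus adjoin_sign_inject by blast
  qed
  have "inj_on order_extension {prec :: 'n set \<Rightarrow> 'n set \<Rightarrow> bool. generalized_partial_term_order prec}"
  proof (rule inj_onI, intro ext)
    fix prec prec' :: "'n set \<Rightarrow> 'n set \<Rightarrow> bool" and \<alpha> \<beta> :: "'n set"
    assume g: "prec \<in> {prec. generalized_partial_term_order prec}"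
      "prec' \<in> {prec. generalized_partial_term_order prec}" and eq: "order_extension prec = order_extension prec'"
    let ?x = "\<lambda>i. (if i \<in> \<beta> then 1 else 0) - (if i \<in> \<alpha> then 1 else 0) :: int"
    have "ternary ?x" by (simp add: ternary_def)
    then have "order_sign prec ?x = order_sign prec' ?x"
    \<comment> \<open>\<open>?x\<close> is zero for \<open>\<alpha> = \<beta>\<close>; the zero
      vector gives no cocircuit and is treated by \<open>m_zero\<close>.\<close>
    proof (cases "?x = 0")
      case True
      have "order_sign prec 0 = 0" "order_sign prec' 0 = 0"
        using sign_order.m_zero[OF sign_order_order_sign] g by blast+
      then show ?thesis unfolding True by simp
    next
      case False
      then show ?thesis using same_sign[OF _ _ eq] \<open>ternary ?x\<close> g by blast
    qed
    then show "prec \<alpha> \<beta> = prec' \<alpha> \<beta>"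
      using g by (simp add: order_sign_determines)
  qed
  then have "bij_betw order_extension {prec :: 'n set \<Rightarrow> 'n set \<Rightarrow> bool. generalized_partial_term_order prec}
      (order_extension ` {prec. generalized_partial_term_order prec})"
    by (rule inj_on_imp_bij_betw)
  moreover have "order_extension ` {prec :: 'n set \<Rightarrow> 'n set \<Rightarrow> bool. generalized_partial_term_order prec}
      \<subseteq> one_element_extensions B_config B_cocircuits"
    using loc by (auto simp: localization_extension_def)
  ultimately show ?thesis using loc unfolding is_localization_def by blast
qed

end
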